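(* Let $n\ge 2$, $n<p<\infty$, and let $\rho$ be an admissible measure on $\mathbb{R}^n$. Suppose $v\in\mathcal{D}^{1,p}(\mathbb{R}^n)$ is an extremal with $$[v]_\rho=\frac{\left|\int_{\mathbb{R}^n}v(y)\,d\rho(y)\right|}{\left|\int_{\mathbb{R}^n}y\,d\rho(y)\right|^{1-n/p}}.$$ If $T_\#\rho=\rho$ for some $T\in\mathcal{S}(n)$, then $v=v\circ T$.
   Context: $\mathcal{D}^{1,p}(\mathbb{R}^n)$ is the space of $u\in L^1_{\rm loc}(\mathbb{R}^n)$ whose weak partial derivatives $u_{x_i}$, $i=1,\dots,n$, all belong to $L^p(\mathbb{R}^n)$. Since $p>n$, each $u$ is identified with its $(1-n/p)$-Hölder continuous representative. $\|Du\|_p:=\left(\int_{\mathbb{R}^n}|Du|^p\,dx\right)^{1/p}$. An admissible measure is a signed Borel measure $\rho$ on $\mathbb{R}^n$ with compact support, $\rho(\mathbb{R}^n)=0$, and $\int_{\mathbb{R}^n}y\,d\rho(y)\ne 0$. $\mathcal{S}(n)$ is the set of similarity transformations $S(y)=\lambda Oy+z$ of $\mathbb{R}^n$ with $\lambda>0$, $O\in\mathrm{O}(n)$, $z\in\mathbb{R}^n$. The push forward is $(S_\#\rho)(A)=\rho(S^{-1}(A))$ for Borel $A\subset\mathbb{R}^n$. For $u\in\mathcal{D}^{1,p}(\mathbb{R}^n)$, $$[u]_\rho:=\sup\left\{\frac{\left|\int u\,d\mu\right|}{\left|\int x\,d\mu(x)\right|^{1-n/p}}:\ \mu=S_\#\rho,\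 S\in\mathcal{S}(n)\right\}.$$ $C_*$ is the smallest constant $C$ such that the generalized Morrey inequality $[u]_\rho\le C\|Du\|_p$ holds for all $u\in\mathcal{D}^{1,p}(\mathbb{R}^n)$. An extremal is a $u\in\mathcal{D}^{1,p}(\mathbb{R}^n)$ with $[u]_\rho=C_*\|Du\|_p$. *)

theory Defs
  imports "HOL-Analysis.Analysis"
begin

section \<open>Signed Borel measures\<close>

text \<open>
  A signed measure is a countably additive function on the Borel sets. Real values lose nothing
  here: a signed measure with a finite value on the whole space is finite on every Borel set.
  Values on non-Borel sets are irrelevant, so equality of signed measures is equality on
  \<^term>\<open>sets borel\<close>.
\<close>

definition signed_borel_measure :: "('a::topological_space set \<Rightarrow> real) \<Rightarrow> bool" where
  "signed_borel_measure \<rho> \<longleftrightarrow> \<rho> {} = 0 \<and>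
     (\<forall>A :: nat \<Rightarrow> 'a set. range A \<subseteq> sets borel \<longrightarrow> disjoint_family A \<longrightarrow>
        (\<lambda>i. \<rho> (A i)) sums \<rho> (\<Union>i. A i))"

text \<open>The Jordan decomposition: $\rho^+(A) = \sup\{\rho(B) : B \subseteq A\}$ and
  $\rho^- = (-\rho)^+$. Truncation of negative values by \<^const>\<open>ennreal\<close> is harmless, since
  $B = \emptyset$ contributes the value 0.\<close>

definition pos_part :: "('a::topological_space set \<Rightarrow> real) \<Rightarrow> 'a measure" where
  "pos_part \<rho> = measure_of UNIV (sets borel) (\<lambda>A. SUP B\<in>{B \<in> sets borel. B \<subseteq> A}. ennreal (\<rho> B))"

definition neg_part :: "('a::topological_space set \<Rightarrow> real) \<Rightarrow> 'a measure" where
  "neg_part \<rho> = pos_part (\<lambda>A. - \<rho> A)"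

definition signed_integral ::
  "('a::topological_space set \<Rightarrow> real) \<Rightarrow> ('a \<Rightarrow> 'b::{banach, second_countable_topology}) \<Rightarrow> 'b" where
  "signed_integral \<rho> f = (\<integral>x. f x \<partial>pos_part \<rho>) - (\<integral>x. f x \<partial>neg_part \<rho>)"

definition signed_support :: "('a::topological_space set \<Rightarrow> real) \<Rightarrow> 'a set" where
  "signed_support \<rho> =
     {x. \<forall>U. open U \<longrightarrow> x \<in> U \<longrightarrow> emeasure (pos_part \<rho>) U + emeasure (neg_part \<rho>) U > 0}"

definition push_forward :: "('a \<Rightarrow> 'b) \<Rightarrow> ('a set \<Rightarrow> real) \<Rightarrow> ('b set \<Rightarrow> real)" where
  "push_forward S \<rho> = (\<lambda>A. \<rho> (S -` A))"

definition admissible :: "((real^'n) set \<Rightarrow> real) \<Rightarrow> bool" where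
  "admissible \<rho> \<longleftrightarrow> signed_borel_measure \<rho> \<and> compact (signed_support \<rho>) \<and> \<rho> UNIV = 0 \<and>
     signed_integral \<rho> (\<lambda>y. y) \<noteq> 0"

definition similarities :: "(real^'n \<Rightarrow> real^'n) set" where
  "similarities = {S. \<exists>l Q z. l > 0 \<and> orthogonal_transformation Q \<and> S = (\<lambda>y. l *\<^sub>R Q y + z)}"


section \<open>Weak derivatives and the homogeneous Sobolev space\<close>

definition partial_deriv :: "'n \<Rightarrow> (real^'n \<Rightarrow> real) \<Rightarrow> real^'n \<Rightarrow> real" where
  "partial_deriv i f x = frechet_derivative f (at x) (axis i 1)"

primrec C_k :: "nat \<Rightarrow> (real^'n \<Rightarrow> real) \<Rightarrow> bool" where
  "C_k 0 f \<longleftrightarrow> continuous_on UNIV f"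
| "C_k (Suc k) f \<longleftrightarrow> (\<forall>x. f differentiable at x) \<and> (\<forall>i. C_k k (partial_deriv i f))"

definition test_function :: "(real^'n \<Rightarrow> real) \<Rightarrow> bool" where
  "test_function \<phi> \<longleftrightarrow> (\<forall>k. C_k k \<phi>) \<and> compact (closure {x. \<phi> x \<noteq> 0})"

definition locally_integrable :: "(real^'n \<Rightarrow> real) \<Rightarrow> bool" where
  "locally_integrable f \<longleftrightarrow> (\<forall>K. compact K \<longrightarrow> set_integrable lborel K f)"

definition Lp :: "real \<Rightarrow> (real^'n \<Rightarrow> real) set" where
  "Lp p = {f. f \<in> borel_measurable lborel \<and> integrable lborel (\<lambda>x. \<bar>f x\<bar> powr p)}"

definition has_weak_partial :: "(real^'n \<Rightarrow> real) \<Rightarrow> 'n \<Rightarrow> (real^'n \<Rightarrow> real) \<Rightarrow> bool" where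
  "has_weak_partial u i g \<longleftrightarrow> locally_integrable g \<and>
     (\<forall>\<phi>. test_function \<phi> \<longrightarrow>
        (\<integral>x. u x * partial_deriv i \<phi> x \<partial>lborel) = - (\<integral>x. g x * \<phi> x \<partial>lborel))"

text \<open>Weak partial derivatives are unique only up to null sets; a representative is chosen.\<close>

definition weak_partial :: "(real^'n \<Rightarrow> real) \<Rightarrow> 'n \<Rightarrow> real^'n \<Rightarrow> real" where
  "weak_partial u i = (SOME g. has_weak_partial u i g)"

definition weak_grad :: "(real^'n \<Rightarrow> real) \<Rightarrow> real^'n \<Rightarrow> real^'n" where
  "weak_grad u x = (\<chi> i. weak_partial u i x)"

definition grad_norm :: "real \<Rightarrow> (real^'n \<Rightarrow> real) \<Rightarrow> real" where
  "grad_norm p u = (\<integral>x. norm (weak_grad u x) powr p \<partial>lborel) powr (1 / p)"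

definition hoelder :: "real \<Rightarrow> (real^'n \<Rightarrow> real) \<Rightarrow> bool" where
  "hoelder a u \<longleftrightarrow> (\<exists>K. \<forall>x y. \<bar>u x - u y\<bar> \<le> K * norm (x - y) powr a)"

text \<open>The elements of $\mathcal{D}^{1,p}(\mathbb{R}^n)$ for $p > n$, each identified with its
  $(1-n/p)$-Hoelder continuous representative, which is unique and exists by Morrey's theorem.\<close>

definition D1p :: "real \<Rightarrow> (real^'n \<Rightarrow> real) set" where
  "D1p p = {u. locally_integrable u \<and> (\<forall>i. \<exists>g \<in> Lp p. has_weak_partial u i g) \<and>
     hoelder (1 - real CARD('n) / p) u}"


section \<open>The generalized Morrey inequality\<close>

definition morrey_quotient :: "real \<Rightarrow> ((real^'n) set \<Rightarrow> real) \<Rightarrow> (real^'n \<Rightarrow> real) \<Rightarrow> real" where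
  "morrey_quotient p \<mu> u =
     \<bar>signed_integral \<mu> u\<bar> / norm (signed_integral \<mu> (\<lambda>x. x)) powr (1 - real CARD('n) / p)"

definition morrey_seminorm :: "real \<Rightarrow> ((real^'n) set \<Rightarrow> real) \<Rightarrow> (real^'n \<Rightarrow> real) \<Rightarrow> ennreal" where
  "morrey_seminorm p \<rho> u = (SUP S\<in>similarities. ennreal (morrey_quotient p (push_forward S \<rho>) u))"

text \<open>The infimum is attained: the inequalities are preserved by limits of the constant \<open>C\<close>.\<close>

definition morrey_const :: "real \<Rightarrow> ((real^'n) set \<Rightarrow> real) \<Rightarrow> ennreal" where
  "morrey_const p \<rho> =
     Inf {C. \<forall>u \<in> D1p p. morrey_seminorm p \<rho> u \<le> C * ennreal (grad_norm p u)}"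

definition extremal :: "real \<Rightarrow> ((real^'n) set \<Rightarrow> real) \<Rightarrow> (real^'n \<Rightarrow> real) \<Rightarrow> bool" where
  "extremal p \<rho> v \<longleftrightarrow>
     v \<in> D1p p \<and> morrey_seminorm p \<rho> v = morrey_const p \<rho> * ennreal (grad_norm p v)"

end

theory Submission
  imports Defs
begin

text \<open>
  Comparing first moments shows that \<open>T\<close> is an isometry, so \<open>w = v \<circ> T\<close> has the same gradient
  norm as \<open>v\<close> and the same integral against \<open>\<rho>\<close>. The midpoint \<open>u = (v + w) / 2\<close> therefore
  satisfies \<open>[u]\<^sub>\<rho> \<ge> [v]\<^sub>\<rho>\<close>, and the Morrey inequality forces the gradient norm of \<open>u\<close> to be at
  least that of \<open>v\<close>. By strict convexity of the \<open>L\<^sup>p\<close> norm, \<open>v\<close> and \<open>w\<close> have the same weak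
  gradient, hence differ by a constant \<open>c\<close>; integrating \<open>v = v \<circ> T + c\<close> against the positive part
  of \<open>\<rho>\<close>, which is finite, nonzero and \<open>T\<close>-invariant, gives \<open>c = 0\<close>.

  The division by the Morrey constant needs it to be finite and nonzero. If it is infinite, then the
  gradient norm of \<open>v\<close> is 0 because \<open>[v]\<^sub>\<rho>\<close> is finite, and \<open>v\<close> is constant. It is not 0 because test
  functions separate the two parts of \<open>\<rho>\<close>.
\<close>

section \<open>Signed Borel measures\<close>

text \<open>Since \<open>\<rho>\<close> has total mass 0, integrating
  \<open>v = v \<circ> T + c\<close> against \<open>\<rho>\<close> itself says nothing about
  \<open>c\<close>; hence the Jordan parts are needed as genuine finite measures, and their
  invariance has to be derived from that of \<open>\<rho>\<close>. The weak gradient is an arbitrary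
  choice of representative, so all information on it holds almost everywhere and rests on uniqueness
  of weak derivatives. Products of one-variable bumps serve as test functions throughout: their
  limits include indicators of boxes, so they determine measures; their increments along a
  coordinate axis are partial derivatives of such products, so a continuous function with zero weak
  gradient is seen to be constant without mollification. Strict convexity is available because p > n
  \<ge> 2: for p \<ge> 2 the p-th power of the norm is a convex increasing function of the squared
  norm, and the parallelogram identity does the rest. The midpoint loses nothing because the
  integrals of \<open>v\<close> and \<open>w\<close> against \<open>\<rho>\<close> agree including
  their sign, not only in absolute value.\<close>

lemma signed_borel_measure_uminus:
  "signed_borel_measure \<rho> \<Longrightarrow> signed_borel_measure (\<lambda>A. - \<rho> A)"
  unfolding signed_borel_measure_def by (auto intro!: sums_minus)

lemma signed_borel_measure_sums:
  fixes A :: "nat \<Rightarrow> 'a::topological_space set"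
  assumes "signed_borel_measure \<rho>" "\<And>i. A i \<in> sets borel" "disjoint_family A"
  shows "(\<lambda>i. \<rho> (A i)) sums \<rho> (\<Union>i. A i)"
  using assms unfolding signed_borel_measure_def by blast

lemma signed_borel_measure_Un:
  assumes "signed_borel_measure \<rho>" "A \<in> sets borel" "B \<in> sets borel" "A \<inter> B = {}"
  shows "\<rho> (A \<union> B) = \<rho> A + \<rho> B"
proof -
  have "(\<lambda>i. \<rho> (binaryset A B i)) sums \<rho> (\<Union>i. binaryset A B i)"
    using assms by (intro signed_borel_measure_sums)
      (auto simp: binaryset_def disjoint_family_on_def)
  moreover have "(\<lambda>i. \<rho> (binaryset A B i)) sums (\<rho> A + \<rho> B)"
    using binaryset_sums[of \<rho> A B] assms(1) by (simp add: signed_borel_measure_def)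
  ultimately show ?thesis
    by (metis sums_unique2 UN_binaryset_eq)
qed

lemma signed_borel_measure_Diff:
  assumes "signed_borel_measure \<rho>" "A \<in> sets borel" "B \<in> sets borel" "B \<subseteq> A"
  shows "\<rho> (A - B) = \<rho> A - \<rho> B"
  using signed_borel_measure_Un[OF assms(1), of B "A - B"] assms
  by (simp add: Un_absorb1 sets.Diff)

text \<open>If \<open>\<rho>\<close> were unbounded, one could split off forever pieces of absolute value at least 1
  from a set on whose subsets \<open>\<rho>\<close> is unbounded, contradicting countable additivity.\<close>

lemma signed_borel_measure_bounded:
  fixes \<rho> :: "'a::topological_space set \<Rightarrow> real"
  assumes \<rho>: "signed_borel_measure \<rho>"
  shows "\<exists>K. \<forall>B\<in>sets borel. \<bar>\<rho> B\<bar> \<le> K"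
proof (rule ccontr)
  assume neg: "\<nexists>K. \<forall>B\<in>sets borel. \<bar>\<rho> B\<bar> \<le> K"
  define unb where "unb A \<longleftrightarrow> A \<in> sets borel \<and>
    (\<forall>K. \<exists>B\<in>sets borel. B \<subseteq> A \<and> K < \<bar>\<rho> B\<bar>)" for A
  have step: "\<exists>A'. unb A' \<and> A' \<subseteq> A \<and> \<bar>\<rho> (A - A')\<bar> \<ge> 1" if "unb A" for A
  proof -
    have A: "A \<in> sets borel" using that by (simp add: unb_def)
    \<comment> \<open>The margin 1 over \<open>\<bar>\<rho> A\<bar>\<close> makes both
      \<open>\<rho> E\<close> and \<open>\<rho> (A - E)\<close> at least 1 in absolute value, so
      either half can be the piece that is split off.\<close>
    obtain E where E: "E \<in> sets borel" "E \<subseteq> A" "\<bar>\<rho> A\<bar> + 1 < \<bar>\<rho> E\<bar>"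
      using \<open>unb A\<close> unfolding unb_def by blast
    have d: "\<rho> (A - E) = \<rho> A - \<rho> E"
      using E A by (intro signed_borel_measure_Diff \<rho>)
    have AE: "A - (A - E) = E" using E by blast
    have "unb E \<or> unb (A - E)"
    proof (rule ccontr)
      assume "\<not> (unb E \<or> unb (A - E))"
      then obtain K L where K: "\<And>B. B \<in> sets borel \<Longrightarrow> B \<subseteq> E \<Longrightarrow> \<bar>\<rho> B\<bar> \<le> K"
        and L: "\<And>B. B \<in> sets borel \<Longrightarrow> B \<subseteq> A - E \<Longrightarrow> \<bar>\<rho> B\<bar> \<le> L"
        using E A unfolding unb_def by (metis not_le sets.Diff)
      have "\<bar>\<rho> B\<bar> \<le> K + L" if B: "B \<in> sets borel" "B \<subseteq> A" for B
      proof -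
        have "\<rho> B = \<rho> (B \<inter> E) + \<rho> (B - E)"
          using signed_borel_measure_Un[OF \<rho>, of "B \<inter> E" "B - E"] B E
          by (simp add: Int_Diff_Un Int_Diff_disjoint sets.Diff sets.Int)
        moreover have "\<bar>\<rho> (B \<inter> E)\<bar> \<le> K" using B E by (intro K) auto
        moreover have "\<bar>\<rho> (B - E)\<bar> \<le> L" using B E by (intro L) auto
        ultimately show ?thesis by linarith
      qed
      then show False using \<open>unb A\<close> unfolding unb_def by (metis not_le)
    qed
    then show ?thesis
    proof
      assume "unb E"
      then show ?thesis using E d by (intro exI[of _ E]) auto
    next
      assume "unb (A - E)"
      then show ?thesis using E AE by (intro exI[of _ "A - E"]) auto
    qed
  qed
  have "unb UNIV"
    using neg unfolding unb_def by (auto simp: not_le)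
  then obtain A where A: "\<And>n::nat. unb (A n)" "\<And>n. A (Suc n) \<subseteq> A n"
      "\<And>n. \<bar>\<rho> (A n - A (Suc n))\<bar> \<ge> 1"
    using dependent_nat_choice[of "\<lambda>_. unb" "\<lambda>_ A A'. A' \<subseteq> A \<and> \<bar>\<rho> (A - A')\<bar> \<ge> 1"] step
    by metis
  define D where "D n = A n - A (Suc n)" for n
  have mono: "A n \<subseteq> A m" if "m \<le> n" for m n
    using lift_Suc_antimono_le[of A] A(2) that by blast
  have "disjoint_family D"
    unfolding disjoint_family_on_def
  proof (intro ballI impI)
    fix m n :: nat assume "m \<noteq> n"
    then consider "Suc m \<le> n" | "Suc n \<le> m" by linarith
    then show "D m \<inter> D n = {}"
      using mono unfolding D_def by cases blast+
  qed
  moreover have "D n \<in> sets borel" for n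
    using A(1) unfolding D_def unb_def by auto
  ultimately have "(\<lambda>i. \<rho> (D i)) sums \<rho> (\<Union>i. D i)"
    by (intro signed_borel_measure_sums \<rho>)
  then have "(\<lambda>i. \<rho> (D i)) \<longlonglongrightarrow> 0"
    using summable_LIMSEQ_zero sums_summable by blast
  then have "\<forall>\<^sub>F i in sequentially. \<bar>\<rho> (D i)\<bar> < 1"
    using order_tendstoD(2)[OF tendsto_rabs_zero, of _ sequentially 1] by simp
  then show False
    using A(3) unfolding D_def eventually_sequentially by (meson not_le order_refl)
qed

section \<open>Jordan parts as finite measures\<close>

lemma sets_pos_part [simp, measurable_cong]: "sets (pos_part \<rho>) = sets borel"
  using sets.sets_measure_of_eq[of borel] by (simp add: pos_part_def)

lemma sets_neg_part [simp, measurable_cong]: "sets (neg_part \<rho>) = sets borel"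
  unfolding neg_part_def by simp

lemma space_pos_part [simp]: "space (pos_part \<rho>) = UNIV"
  by (metis sets_pos_part sets_eq_imp_space_eq space_borel)

lemma space_neg_part [simp]: "space (neg_part \<rho>) = UNIV"
  unfolding neg_part_def by simp

text \<open>\<open>measure_of\<close> has the intended value only for a measure, so the supremum
  must be shown countably additive. Subsets of disjoint sets can be united, which gives
  superadditivity and one inequality; for the other, a competitor \<open>B\<close> is cut into the
  pieces \<open>B \<inter> A i\<close>.\<close>

lemma emeasure_pos_part:
  fixes \<rho> :: "'a::topological_space set \<Rightarrow> real"
  assumes \<rho>: "signed_borel_measure \<rho>" and A: "A \<in> sets borel"
  shows "emeasure (pos_part \<rho>) A = (SUP B\<in>{B \<in> sets borel. B \<subseteq> A}. ennreal (\<rho> B))"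
proof -
  define f where "f A = (SUP B\<in>{B \<in> sets borel. B \<subseteq> A}. ennreal (\<rho> B))" for A
  have e: "\<rho> {} = 0" using \<rho> by (simp add: signed_borel_measure_def)
  have f0: "f {} = 0" unfolding f_def using e by (auto intro!: antisym SUP_least)
  have super: "f A + f B \<le> f (A \<union> B)" if "A \<inter> B = {}" for A B
  proof -
    have "f A + f B = (SUP C\<in>{C \<in> sets borel. C \<subseteq> A}. SUP D\<in>{D \<in> sets borel. D \<subseteq> B}.
        ennreal (\<rho> C) + ennreal (\<rho> D))"
      unfolding f_def by (subst ennreal_SUP_add_left[symmetric] ennreal_SUP_add_right[symmetric], force)+
        (rule refl)
    also have "\<dots> \<le> f (A \<union> B)"
    proof (intro SUP_least)
      fix C D assume C: "C \<in> {C \<in> sets borel. C \<subseteq> A}" and D: "D \<in> {D \<in> sets borel. D \<subseteq> B}"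
      have "\<exists>E\<in>{E \<in> sets borel. E \<subseteq> A \<union> B}. ennreal (\<rho> C) + ennreal (\<rho> D) \<le> ennreal (\<rho> E)"
      proof -
        \<comment> \<open>\<open>ennreal\<close> truncates at 0: a set of negative value contributes
          nothing and is left out of the union.\<close>
        consider "\<rho> C \<ge> 0" "\<rho> D \<ge> 0" | "\<rho> C < 0" | "\<rho> D < 0" by linarith
        then show ?thesis
        proof cases
          case 1
          have "\<rho> (C \<union> D) = \<rho> C + \<rho> D"
            using C D that by (intro signed_borel_measure_Un \<rho>) auto
          with 1 C D show ?thesis
            by (intro bexI[of _ "C \<union> D"]) (auto simp: ennreal_plus)
        next
          case 2 with D show ?thesis by (intro bexI[of _ D]) (auto simp: ennreal_neg)
        next
          case 3 with C show ?thesis by (intro bexI[of _ C]) (auto simp: ennreal_neg)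
        qed
      qed
      then show "ennreal (\<rho> C) + ennreal (\<rho> D) \<le> f (A \<union> B)"
        unfolding f_def by (meson SUP_upper order_trans)
    qed
    finally show ?thesis .
  qed
  have mono: "f A \<le> f B" if "A \<subseteq> B" for A B
    unfolding f_def by (rule SUP_subset_mono) (use that in auto)
  have "countably_additive (sets borel) f"
    unfolding countably_additive_def
  proof (intro allI impI)
    fix A :: "nat \<Rightarrow> 'a set"
    assume A: "range A \<subseteq> sets borel" and disj: "disjoint_family A"
    show "(\<Sum>i. f (A i)) = f (\<Union>i. A i)"
    proof (rule antisym)
      have "(\<Sum>i<n. f (A i)) \<le> f (\<Union>i<n. A i)" for n
      proof (induction n)
        case (Suc n)
        have "A i \<inter> A n = {}" if "i < n" for i
          using disj that unfolding disjoint_family_on_def by auto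
        then have "(\<Union>i<n. A i) \<inter> A n = {}" by blast
        from super[OF this] have "f (\<Union>i<n. A i) + f (A n) \<le> f (\<Union>i<Suc n. A i)"
          by (simp add: lessThan_Suc Un_commute)
        then show ?case
          using order_trans[OF add_right_mono[OF Suc, of "f (A n)"]] by simp
      qed (simp add: f0)
      moreover have "f (\<Union>i<n. A i) \<le> f (\<Union>i. A i)" for n by (rule mono) auto
      ultimately show "(\<Sum>i. f (A i)) \<le> f (\<Union>i. A i)"
        by (intro suminf_le_const) (auto intro: order_trans)
    next
      show "f (\<Union>i. A i) \<le> (\<Sum>i. f (A i))"
        unfolding f_def[of "\<Union>i. A i"]
      proof (rule SUP_least, safe)
        fix B assume B: "B \<in> sets borel" "B \<subseteq> (\<Union>i. A i)"
        have s: "(\<lambda>i. \<rho> (B \<inter> A i)) sums \<rho> (\<Union>i. B \<inter> A i)"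
          using A B disjoint_family_on_bisimulation[OF disj, of "\<lambda>i. B \<inter> A i"]
          by (intro signed_borel_measure_sums \<rho>) auto
        have BU: "(\<Union>i. B \<inter> A i) = B" using B by blast
        have "ennreal (\<rho> (B \<inter> A i)) \<le> f (A i)" for i
          unfolding f_def using A B by (intro SUP_upper) auto
        then have le: "(\<Sum>i<n. ennreal (\<rho> (B \<inter> A i))) \<le> (\<Sum>i. f (A i))" for n
          by (intro order_trans[OF sum_mono sum_le_suminf]) auto
        \<comment> \<open>Some terms may be negative; truncating each of them separately can only
          enlarge the sum.\<close>
        have "ennreal (\<Sum>i<n. \<rho> (B \<inter> A i)) \<le> (\<Sum>i<n. ennreal (\<rho> (B \<inter> A i)))" for n
        proof (induction n)
          case (Suc n)
          have le: "ennreal (a + b) \<le> ennreal a + ennreal b" for a b :: real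
            by (cases "a \<ge> 0"; cases "b \<ge> 0")
              (auto simp flip: ennreal_plus simp: ennreal_neg intro: ennreal_leI)
          show ?case
            using order_trans[OF le add_right_mono[OF Suc, of "ennreal (\<rho> (B \<inter> A n))"]] by simp
        qed simp
        with le have "ennreal (\<Sum>i<n. \<rho> (B \<inter> A i)) \<le> (\<Sum>i. f (A i))" for n
          using order_trans by blast
        moreover have "(\<lambda>n. ennreal (\<Sum>i<n. \<rho> (B \<inter> A i))) \<longlonglongrightarrow> ennreal (\<rho> B)"
          using s BU unfolding sums_def by (auto intro: tendsto_ennrealI)
        ultimately show "ennreal (\<rho> B) \<le> (\<Sum>i. f (A i))"
          by (intro LIMSEQ_le_const2) auto
      qed
    qed
  qed
  then have "emeasure (pos_part \<rho>) A = f A"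
    unfolding pos_part_def f_def[symmetric]
    using A f0 sets.sigma_algebra_axioms[of "borel :: 'a measure"]
    by (intro emeasure_measure_of_sigma) (auto simp: positive_def)
  then show ?thesis by (simp add: f_def)
qed

lemma finite_measure_pos_part:
  assumes \<rho>: "signed_borel_measure \<rho>"
  shows "finite_measure (pos_part \<rho>)"
proof
  obtain K where K: "\<And>B. B \<in> sets borel \<Longrightarrow> \<bar>\<rho> B\<bar> \<le> K"
    using signed_borel_measure_bounded[OF \<rho>] by blast
  have "emeasure (pos_part \<rho>) UNIV \<le> ennreal K"
    unfolding emeasure_pos_part[OF \<rho>, of UNIV, simplified]
    using K by (intro SUP_least ennreal_leI) (auto dest: abs_le_D1)
  then show "emeasure (pos_part \<rho>) (space (pos_part \<rho>)) \<noteq> \<infinity>"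
    using ennreal_less_top le_less_trans by (fastforce simp: top_unique)
qed

lemma finite_measure_neg_part:
  "signed_borel_measure \<rho> \<Longrightarrow> finite_measure (neg_part \<rho>)"
  unfolding neg_part_def by (intro finite_measure_pos_part signed_borel_measure_uminus)

text \<open>Total mass 0 gives \<open>- \<rho> B = \<rho> (- B)\<close>, so complementation carries
  one supremum into the other.\<close>

lemma emeasure_neg_part_UNIV:
  assumes \<rho>: "signed_borel_measure \<rho>" and "\<rho> UNIV = 0"
  shows "emeasure (neg_part \<rho>) UNIV = emeasure (pos_part \<rho>) UNIV"
proof -
  have c: "- \<rho> B = \<rho> (- B)" if "B \<in> sets borel" for B
    using signed_borel_measure_Diff[OF \<rho>, of UNIV B] that assms(2) by (simp add: Compl_eq_Diff_UNIV)
  have "emeasure (neg_part \<rho>) UNIV = (SUP B\<in>sets borel. ennreal (\<rho> (- B)))"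
    unfolding neg_part_def emeasure_pos_part[OF signed_borel_measure_uminus[OF \<rho>], of UNIV, simplified]
    by (intro SUP_cong) (auto simp: c)
  also have "\<dots> = (SUP B\<in>uminus ` sets borel. ennreal (\<rho> B))"
    by (simp add: image_image)
  also have "uminus ` sets borel = (sets borel :: 'a set set)"
    by (auto simp: image_iff borel_comp intro!: bexI[of _ "- x" for x])
  also have "(SUP B\<in>sets borel. ennreal (\<rho> B)) = emeasure (pos_part \<rho>) UNIV"
    using emeasure_pos_part[OF \<rho>, of UNIV] by simp
  finally show ?thesis .
qed

lemma signed_integral_const:
  assumes "signed_borel_measure \<rho>" "\<rho> UNIV = 0"
  shows "signed_integral \<rho> (\<lambda>_. c) = 0"
  using emeasure_neg_part_UNIV[OF assms] by (simp add: signed_integral_def measure_def)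

section \<open>Support and integrability of continuous functions\<close>

text \<open>The complement of the support is the union of all open sets that are null for both
  parts; by Lindelof, countably many of them suffice.\<close>

lemma AE_signed_support:
  fixes \<rho> :: "'a::second_countable_topology set \<Rightarrow> real"
  shows "AE x in pos_part \<rho>. x \<in> signed_support \<rho>" "AE x in neg_part \<rho>. x \<in> signed_support \<rho>"
proof -
  define \<F> where "\<F> = {U. open U \<and> emeasure (pos_part \<rho>) U = 0 \<and> emeasure (neg_part \<rho>) U = 0}"
  obtain \<G> where \<G>: "\<G> \<subseteq> \<F>" "countable \<G>" "\<Union>\<G> = \<Union>\<F>"
    using Lindelof[of \<F>] unfolding \<F>_def by auto
  have eq: "- signed_support \<rho> = \<Union>\<G>"
    unfolding \<G>(3) signed_support_def \<F>_def by (force simp: not_gr_zero)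
  have n: "\<Union>\<G> \<in> null_sets (pos_part \<rho>)" "\<Union>\<G> \<in> null_sets (neg_part \<rho>)"
    using \<G>(1) null_sets_UN'[OF \<G>(2), of "\<lambda>x. x" "pos_part \<rho>"]
      null_sets_UN'[OF \<G>(2), of "\<lambda>x. x" "neg_part \<rho>"]
    unfolding \<F>_def null_sets_def by (simp_all add: subset_iff)
  have sub: "{x. x \<notin> signed_support \<rho>} \<subseteq> \<Union>\<G>" using eq by blast
  show "AE x in pos_part \<rho>. x \<in> signed_support \<rho>"
    by (rule AE_I'[OF n(1)]) (use sub in simp)
  show "AE x in neg_part \<rho>. x \<in> signed_support \<rho>"
    by (rule AE_I'[OF n(2)]) (use sub in simp)
qed

text \<open>A continuous function is bounded on the compact support, hence almost everywhere, and
  both parts are finite.\<close>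

lemma
  fixes f :: "'a::second_countable_topology \<Rightarrow> 'b::{banach, second_countable_topology}"
  assumes \<rho>: "signed_borel_measure \<rho>" and c: "compact (signed_support \<rho>)" and f: "continuous_on UNIV f"
  shows integrable_pos_part: "integrable (pos_part \<rho>) f"
    and integrable_neg_part: "integrable (neg_part \<rho>) f"
proof -
  have "bounded (f ` signed_support \<rho>)"
    by (intro compact_imp_bounded compact_continuous_image c continuous_on_subset[OF f]) auto
  then obtain B where B: "\<And>x. x \<in> signed_support \<rho> \<Longrightarrow> norm (f x) \<le> B"
    unfolding bounded_iff by blast
  have m: "f \<in> borel_measurable borel" using f by (rule borel_measurable_continuous_onI)
  show "integrable (pos_part \<rho>) f"
    using AE_signed_support(1)[of \<rho>] B m
    by (intro finite_measure.integrable_const_bound[OF finite_measure_pos_part[OF \<rho>], where B=B])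
      (auto cong: measurable_cong_sets)
  show "integrable (neg_part \<rho>) f"
    using AE_signed_support(2)[of \<rho>] B m
    by (intro finite_measure.integrable_const_bound[OF finite_measure_neg_part[OF \<rho>], where B=B])
      (auto cong: measurable_cong_sets)
qed

section \<open>Invariance of the Jordan parts\<close>

text \<open>Taking preimages under \<open>T\<close> is a bijection from the Borel subsets of
  \<open>A\<close> onto those of its preimage, so both suprema run over the same values. The
  continuous inverse \<open>T'\<close> provides surjectivity.\<close>

lemma distr_pos_part_invariant:
  fixes \<rho> :: "'a::topological_space set \<Rightarrow> real"
  assumes \<rho>: "signed_borel_measure \<rho>" and h: "homeomorphism UNIV UNIV T T'"
    and inv: "\<And>A. A \<in> sets borel \<Longrightarrow> \<rho> (T -` A) = \<rho> A"
  shows "distr (pos_part \<rho>) borel T = pos_part \<rho>"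
proof (rule measure_eqI)
  have T: "T \<in> borel_measurable borel" and T': "T' \<in> borel_measurable borel"
    using h unfolding homeomorphism_def by (auto intro: borel_measurable_continuous_onI)
  have TT': "T (T' x) = x" "T' (T x) = x" for x
    using h unfolding homeomorphism_def by auto
  have vim: "S -` A \<in> sets borel" if "S \<in> borel_measurable borel" "A \<in> sets borel"
    for S :: "'a \<Rightarrow> 'a" and A
    using measurable_sets[OF that] by simp
  fix A assume "A \<in> sets (distr (pos_part \<rho>) borel T)"
  then have A: "A \<in> sets borel" by simp
  have "emeasure (distr (pos_part \<rho>) borel T) A = emeasure (pos_part \<rho>) (T -` A)"
    using T A by (subst emeasure_distr) (auto cong: measurable_cong_sets)
  also have "\<dots> = (SUP B\<in>{B \<in> sets borel. B \<subseteq> T -` A}. ennreal (\<rho> B))"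
    using vim[OF T A] by (rule emeasure_pos_part[OF \<rho>])
  also have "\<dots> = (SUP B\<in>{B \<in> sets borel. B \<subseteq> A}. ennreal (\<rho> (T -` B)))"
  proof -
    have "{B \<in> sets borel. B \<subseteq> T -` A} = (\<lambda>B. T -` B) ` {B \<in> sets borel. B \<subseteq> A}"
    proof (intro equalityI subsetI)
      fix B assume B: "B \<in> {B \<in> sets borel. B \<subseteq> T -` A}"
      have "B = T -` (T' -` B)" using TT' by auto
      moreover have "T' -` B \<subseteq> A"
      proof
        fix x assume "x \<in> T' -` B"
        then have "T (T' x) \<in> A" using B by auto
        then show "x \<in> A" by (simp add: TT')
      qed
      ultimately show "B \<in> (\<lambda>B. T -` B) ` {B \<in> sets borel. B \<subseteq> A}"
        using B vim[OF T', of B] by (intro image_eqI[of _ _ "T' -` B"]) auto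
    next
      fix B assume "B \<in> (\<lambda>B. T -` B) ` {B \<in> sets borel. B \<subseteq> A}"
      then show "B \<in> {B \<in> sets borel. B \<subseteq> T -` A}" using vim[OF T] by auto
    qed
    then show ?thesis by (simp only: image_image)
  qed
  also have "\<dots> = emeasure (pos_part \<rho>) A"
    unfolding emeasure_pos_part[OF \<rho> A] by (intro SUP_cong) (auto simp: inv)
  finally show "emeasure (distr (pos_part \<rho>) borel T) A = emeasure (pos_part \<rho>) A" .
qed simp

lemma distr_neg_part_invariant:
  fixes \<rho> :: "'a::topological_space set \<Rightarrow> real"
  assumes "signed_borel_measure \<rho>" "homeomorphism UNIV UNIV T T'"
    and "\<And>A. A \<in> sets borel \<Longrightarrow> \<rho> (T -` A) = \<rho> A"
  shows "distr (neg_part \<rho>) borel T = neg_part \<rho>"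
  unfolding neg_part_def using assms
  by (intro distr_pos_part_invariant signed_borel_measure_uminus) auto

lemma
  fixes \<rho> :: "'a::topological_space set \<Rightarrow> real"
    and f :: "'a \<Rightarrow> 'b::{banach, second_countable_topology}"
  assumes \<rho>: "signed_borel_measure \<rho>" and h: "homeomorphism UNIV UNIV T T'"
    and inv: "\<And>A. A \<in> sets borel \<Longrightarrow> \<rho> (T -` A) = \<rho> A" and f: "f \<in> borel_measurable borel"
  shows integral_pos_part_invariant: "(\<integral>x. f (T x) \<partial>pos_part \<rho>) = (\<integral>x. f x \<partial>pos_part \<rho>)"
    and signed_integral_invariant: "signed_integral \<rho> (\<lambda>x. f (T x)) = signed_integral \<rho> f"
proof -
  have T: "T \<in> borel_measurable borel"
    using h unfolding homeomorphism_def by (auto intro: borel_measurable_continuous_onI)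
  show p: "(\<integral>x. f (T x) \<partial>pos_part \<rho>) = (\<integral>x. f x \<partial>pos_part \<rho>)"
    using integral_distr[of T "pos_part \<rho>" borel f] T f
    by (simp add: distr_pos_part_invariant[OF \<rho> h inv] cong: measurable_cong_sets)
  have n: "(\<integral>x. f (T x) \<partial>neg_part \<rho>) = (\<integral>x. f x \<partial>neg_part \<rho>)"
    using integral_distr[of T "neg_part \<rho>" borel f] T f
    by (simp add: distr_neg_part_invariant[OF \<rho> h inv] cong: measurable_cong_sets)
  from p n show "signed_integral \<rho> (\<lambda>x. f (T x)) = signed_integral \<rho> f"
    by (simp add: signed_integral_def)
qed

section \<open>Lebesgue measure and isometries\<close>

lemma distr_lborel_reflect:
  fixes c :: "'a::euclidean_space"
  shows "distr lborel borel (\<lambda>x. c - x) = lborel"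
  by (subst lborel_affine[of "-1" c]) (auto simp: density_1 one_ennreal_def[symmetric])

lemma nn_integral_lborel_translate:
  fixes f :: "'a::euclidean_space \<Rightarrow> ennreal"
  assumes [measurable]: "f \<in> borel_measurable borel"
  shows "(\<integral>\<^sup>+x. f (x + c) \<partial>lborel) = (\<integral>\<^sup>+x. f x \<partial>lborel)"
  by (subst lborel_distr_plus[of c, symmetric]) (simp add: nn_integral_distr add.commute)

lemma nn_integral_lborel_reflect:
  fixes f :: "'a::euclidean_space \<Rightarrow> ennreal"
  assumes [measurable]: "f \<in> borel_measurable borel"
  shows "(\<integral>\<^sup>+x. f (c - x) \<partial>lborel) = (\<integral>\<^sup>+x. f x \<partial>lborel)"
  by (subst distr_lborel_reflect[of c, symmetric]) (simp add: nn_integral_distr)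

text \<open>Both sides are multiplied by the volume of the unit ball; Tonelli's theorem and the invariance
  of the ball under \<open>Q\<close> then move \<open>Q\<close> from one factor to the other. (The determinant formula of
  the library requires a well-ordered index type.)\<close>

lemma nn_integral_lborel_orthogonal:
  fixes f :: "'a::euclidean_space \<Rightarrow> ennreal" and Q :: "'a \<Rightarrow> 'a"
  assumes Q: "orthogonal_transformation Q" and [measurable]: "f \<in> borel_measurable borel"
  shows "(\<integral>\<^sup>+x. f (Q x) \<partial>lborel) = (\<integral>\<^sup>+x. f x \<partial>lborel)"
proof -
  have lin: "linear Q" using Q by (simp add: orthogonal_transformation_linear)
  have [measurable]: "Q \<in> borel_measurable borel"
    using lin by (intro borel_measurable_continuous_onI linear_continuous_on linear_conv_bounded_linear[THEN iffD1])
  define B :: "'a set" where "B = ball 0 1"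
  define h :: "'a \<Rightarrow> ennreal" where "h = indicator B"
  have [measurable]: "h \<in> borel_measurable borel"
    unfolding h_def B_def by (rule borel_measurable_indicator) simp
  have hQ: "h (Q x) = h x" for x
    unfolding h_def B_def using orthogonal_transformation_norm[OF Q] by (simp add: indicator_def)
  have vol: "(\<integral>\<^sup>+x. h x \<partial>lborel) = emeasure lborel B"
    unfolding h_def B_def by (subst nn_integral_indicator) auto
  have fin: "emeasure lborel B \<noteq> 0" "emeasure lborel B \<noteq> \<infinity>"
    unfolding B_def
    using less_imp_neq[OF unit_ball_vol_pos[OF of_nat_0_le_iff], of "DIM('a)"] emeasure_lborel_ball_finite[of "0::'a" 1]
    by (auto simp: emeasure_ball less_top)
  have "emeasure lborel B * (\<integral>\<^sup>+y. f (Q y) \<partial>lborel) = (\<integral>\<^sup>+y. f (Q y) * (\<integral>\<^sup>+x. h x \<partial>lborel) \<partial>lborel)"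
    by (simp add: nn_integral_multc vol, simp add: mult.commute)
  also have "\<dots> = (\<integral>\<^sup>+y. (\<integral>\<^sup>+x. f (Q y) * h (x + - Q y) \<partial>lborel) \<partial>lborel)"
    by (subst nn_integral_cmult, measurable, subst nn_integral_lborel_translate) auto
  also have "\<dots> = (\<integral>\<^sup>+x. (\<integral>\<^sup>+y. f (Q y) * h (x + - Q y) \<partial>lborel) \<partial>lborel)"
    by (rule lborel_pair.Fubini') measurable
  also have "\<dots> = (\<integral>\<^sup>+x. (\<integral>\<^sup>+y. f (x - Q y) * h y \<partial>lborel) \<partial>lborel)"
  proof (rule nn_integral_cong)
    fix x
    obtain x' where x: "x = Q x'" using orthogonal_transformation_surj[OF Q] by (metis surj_def)
    have "(\<integral>\<^sup>+y. f (Q y) * h (x + - Q y) \<partial>lborel) = (\<integral>\<^sup>+y. f (Q (x' - y)) * h (x + - Q (x' - y)) \<partial>lborel)"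
      by (rule nn_integral_lborel_reflect[symmetric]) measurable
    also have "\<dots> = (\<integral>\<^sup>+y. f (x - Q y) * h y \<partial>lborel)"
      by (simp add: linear_diff[OF lin] x hQ)
    finally show "(\<integral>\<^sup>+y. f (Q y) * h (x + - Q y) \<partial>lborel) = (\<integral>\<^sup>+y. f (x - Q y) * h y \<partial>lborel)" .
  qed
  also have "\<dots> = (\<integral>\<^sup>+y. (\<integral>\<^sup>+x. f (x - Q y) * h y \<partial>lborel) \<partial>lborel)"
    by (rule lborel_pair.Fubini') measurable
  also have "\<dots> = (\<integral>\<^sup>+y. (\<integral>\<^sup>+x. f x \<partial>lborel) * h y \<partial>lborel)"
    using nn_integral_lborel_translate[of f "- Q y" for y]
    by (intro nn_integral_cong) (simp add: nn_integral_multc)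
  also have "\<dots> = emeasure lborel B * (\<integral>\<^sup>+x. f x \<partial>lborel)"
    by (simp add: nn_integral_cmult vol, simp add: mult.commute)
  finally show ?thesis
    using fin by (simp add: ennreal_mult_cancel_left)
qed

lemma distr_lborel_isometry:
  fixes Q :: "'a::euclidean_space \<Rightarrow> 'a"
  assumes Q: "orthogonal_transformation Q"
  shows "distr lborel borel (\<lambda>x. Q x + z) = lborel"
proof (rule measure_eqI)
  have lin: "linear Q" using Q by (simp add: orthogonal_transformation_linear)
  have [measurable]: "Q \<in> borel_measurable borel"
    using lin by (intro borel_measurable_continuous_onI linear_continuous_on linear_conv_bounded_linear[THEN iffD1])
  fix A assume "A \<in> sets (distr lborel borel (\<lambda>x. Q x + z))"
  then have A[measurable]: "A \<in> sets borel" by simp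
  have "emeasure (distr lborel borel (\<lambda>x. Q x + z)) A
      = (\<integral>\<^sup>+x. indicator A x \<partial>distr lborel borel (\<lambda>x. Q x + z))"
    by simp
  also have "\<dots> = (\<integral>\<^sup>+x. indicator A (Q x + z) \<partial>lborel)"
    by (subst nn_integral_distr) auto
  also have "\<dots> = (\<integral>\<^sup>+x. indicator A x \<partial>lborel)"
    by (subst nn_integral_lborel_orthogonal[OF Q, of "\<lambda>x. indicator A (x + z)"], measurable)
      (subst nn_integral_lborel_translate, auto)
  finally show "emeasure (distr lborel borel (\<lambda>x. Q x + z)) A = emeasure lborel A" by simp
qed simp

section \<open>Smooth functions of one variable\<close>

text \<open>The witness is the whole sequence of derivatives: closure properties become operations
  on sequences, and orders of differentiation can be tracked coordinate by coordinate.\<close>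

definition smooth_real :: "(real \<Rightarrow> real) \<Rightarrow> bool" where
  "smooth_real f \<longleftrightarrow> (\<exists>F. F 0 = f \<and> (\<forall>n x. (F n has_real_derivative F (Suc n) x) (at x)))"

lemma smooth_real_antiderivative:
  assumes "smooth_real f" "\<And>x. (G has_real_derivative f x) (at x)"
  shows "smooth_real G"
proof -
  obtain F where F: "F 0 = f" "\<And>n x. (F n has_real_derivative F (Suc n) x) (at x)"
    using assms unfolding smooth_real_def by blast
  show ?thesis
    unfolding smooth_real_def
  proof (intro exI[of _ "case_nat G F"] conjI allI)
    show "(case_nat G F n has_real_derivative case_nat G F (Suc n) x) (at x)" for n x
      using F assms(2) by (cases n) auto
  qed simp
qed

lemma smooth_real_shift_diff:
  assumes "smooth_real f"
  shows "smooth_real (\<lambda>t. f (t + c) - f t)"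
proof -
  obtain F where F: "F 0 = f" "\<And>n x. (F n has_real_derivative F (Suc n) x) (at x)"
    using assms unfolding smooth_real_def by blast
  have "((\<lambda>t. F n (t + c) - F n t) has_real_derivative F (Suc n) (x + c) - F (Suc n) x) (at x)" for n x
    by (intro DERIV_diff F(2)) (use F(2)[of n "x + c"] DERIV_shift in blast)
  then show ?thesis
    unfolding smooth_real_def using F(1) by (intro exI[of _ "\<lambda>n t. F n (t + c) - F n t"]) simp
qed

lemma smooth_real_has_derivative:
  assumes "smooth_real f"
  obtains f' where "smooth_real f'" "\<And>x. (f has_real_derivative f' x) (at x)"
proof -
  obtain F where F: "F 0 = f" "\<And>n x. (F n has_real_derivative F (Suc n) x) (at x)"
    using assms unfolding smooth_real_def by blast
  have "smooth_real (F (Suc 0))"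
    unfolding smooth_real_def using F(2) by (intro exI[of _ "\<lambda>n. F (Suc n)"]) simp
  with F show ?thesis by (metis that)
qed

text \<open>The powers of \<open>s\<close> in the denominator make the family closed under
  differentiation up to linear combinations; it starts with \<open>exp (- 1 / s)\<close> extended by
  0.\<close>

definition flat_exp :: "nat \<Rightarrow> real \<Rightarrow> real" where
  "flat_exp m s = (if s > 0 then exp (- 1 / s) / s ^ m else 0)"

text \<open>The single term of index \<open>m + 2\<close> of the exponential series bounds
  \<open>exp (1 / s)\<close> from below. Two powers of \<open>s\<close> are left over, which makes
  the difference quotients of \<open>flat_exp m\<close> at 0 tend to 0.\<close>

lemma flat_exp_le:
  assumes "s > 0"
  shows "flat_exp m s \<le> fact (m + 2) * s ^ 2"
proof -
  have "(1 / s) ^ (m + 2) / fact (m + 2) \<le> exp (1 / s)"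
  proof -
    have s: "(\<lambda>n. (1 / s) ^ n /\<^sub>R fact n) sums exp (1 / s)" by (rule exp_converges)
    have "(\<Sum>n\<in>{m + 2}. (1 / s) ^ n /\<^sub>R fact n) \<le> exp (1 / s)"
      unfolding sums_unique[OF s] using s assms by (intro sum_le_suminf) (auto simp: sums_iff)
    then show ?thesis by (simp add: divide_inverse mult.commute)
  qed
  then have "exp (- 1 / s) \<le> fact (m + 2) * s ^ (m + 2)"
    using assms by (simp add: exp_minus field_simps del: fact_Suc)
  then show ?thesis
    using assms by (simp add: flat_exp_def divide_simps power_add power2_eq_square mult.commute mult.left_commute del: fact_Suc)
qed

lemma flat_exp_nonneg: "0 \<le> flat_exp m s"
  by (simp add: flat_exp_def)

lemma flat_exp_mult: "s ^ k * flat_exp (m + k) s = flat_exp m s"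
  by (simp add: flat_exp_def power_add)

lemma flat_exp_has_derivative:
  "(flat_exp m has_real_derivative flat_exp (m + 2) s - real m * flat_exp (m + 1) s) (at s)"
proof -
  consider "s < 0" | "s = 0" | "s > 0" by linarith
  then show ?thesis
  proof cases
    case 1
    have "((\<lambda>_. 0) has_real_derivative 0) (at s)" by simp
    then have "(flat_exp m has_real_derivative 0) (at s)"
      by (rule has_field_derivative_transform_within_open[of _ _ _ "{..<0}"]) (use 1 in \<open>auto simp: flat_exp_def\<close>)
    then show ?thesis using 1 by (simp add: flat_exp_def)
  next
    case 2
    have "((\<lambda>h. (flat_exp m (0 + h) - flat_exp m 0) / h) \<longlongrightarrow> 0) (at 0)"
    proof (rule Lim_null_comparison)
      show "\<forall>\<^sub>F h in at 0. norm ((flat_exp m (0 + h) - flat_exp m 0) / h) \<le> fact (m + 2) * \<bar>h\<bar>"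
      proof (intro always_eventually allI)
        fix h :: real
        show "norm ((flat_exp m (0 + h) - flat_exp m 0) / h) \<le> fact (m + 2) * \<bar>h\<bar>"
        proof (cases "h > 0")
          case True
          then show ?thesis using flat_exp_le[OF True, of m] flat_exp_nonneg[of m h]
            by (simp add: flat_exp_def[of m 0] field_simps power2_eq_square del: fact_Suc)
        next
          case False
          have "0 \<le> fact (m + 2) * \<bar>h\<bar>" by (intro mult_nonneg_nonneg) auto
          with False show ?thesis by (simp add: flat_exp_def del: fact_Suc)
        qed
      qed
      have "((\<lambda>h::real. fact (m + 2) * \<bar>h\<bar>) \<longlongrightarrow> fact (m + 2) * \<bar>0\<bar>) (at 0)"
        by (intro tendsto_intros)
      then show "((\<lambda>h::real. fact (m + 2) * \<bar>h\<bar>) \<longlongrightarrow> 0) (at 0)" by simp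
    qed
    then have "(flat_exp m has_real_derivative 0) (at 0)" by (simp add: DERIV_def)
    with 2 show ?thesis by (simp add: flat_exp_def)
  next
    case 3
    have pow: "((\<lambda>s. s ^ m) has_real_derivative real m * s ^ m / s) (at s)"
      by (rule DERIV_cong[OF DERIV_pow]) (use 3 in \<open>cases m; simp\<close>)
    have "((\<lambda>s. exp (- 1 / s) / s ^ m) has_real_derivative
        exp (- 1 / s) / s ^ (m + 2) - real m * (exp (- 1 / s) / s ^ (m + 1))) (at s)"
    proof (rule DERIV_cong[OF DERIV_divide[OF _ pow]])
      show "((\<lambda>s. exp (- 1 / s)) has_real_derivative exp (- 1 / s) / s\<^sup>2) (at s)"
        using 3 by (auto intro!: derivative_eq_intros simp: power2_eq_square)
    qed (use 3 in \<open>simp_all add: field_simps power2_eq_square\<close>)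
    then have "(flat_exp m has_real_derivative
        exp (- 1 / s) / s ^ (m + 2) - real m * (exp (- 1 / s) / s ^ (m + 1))) (at s)"
      by (rule has_field_derivative_transform_within_open[of _ _ _ "{0<..}"]) (use 3 in \<open>auto simp: flat_exp_def\<close>)
    then show ?thesis using 3 by (simp add: flat_exp_def)
  qed
qed

text \<open>The \<open>n\<close>-th derivative of \<open>exp (- 1 / q(t))\<close> is \<open>P\<^sub>n(t) exp (- 1 / q(t)) / q(t)\<^bsup>2n\<^esup>\<close> with a
  polynomial \<open>P\<^sub>n\<close>.\<close>

lemma smooth_real_flat_exp_poly: "smooth_real (\<lambda>t. flat_exp 0 (poly q t))"
proof -
  define P where "P = rec_nat 1 (\<lambda>n p.
    pderiv p * q ^ 2 + p * pderiv q - smult (real (2 * n)) (p * pderiv q * q))"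
  have P: "P 0 = 1" "P (Suc n) =
    pderiv (P n) * q ^ 2 + P n * pderiv q - smult (real (2 * n)) (P n * pderiv q * q)" for n
    by (simp_all add: P_def)
  have "((\<lambda>t. poly (P n) t * flat_exp (2 * n) (poly q t)) has_real_derivative
      poly (P (Suc n)) x * flat_exp (2 * Suc n) (poly q x)) (at x)" for n x
  proof -
    let ?E = "flat_exp (2 * n + 2) (poly q x)"
    have d: "((\<lambda>t. flat_exp (2 * n) (poly q t)) has_real_derivative
        (?E - real (2 * n) * flat_exp (2 * n + 1) (poly q x)) * poly (pderiv q) x) (at x)"
      by (rule DERIV_chain2[OF flat_exp_has_derivative poly_DERIV])
    \<comment> \<open>The product and chain rules produce the exponents 2n, 2n + 1 and 2n + 2; all
      terms are put over the exponent 2n + 2, which is also valid where \<open>q\<close> is not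
      positive since both sides are 0 there.\<close>
    have e: "flat_exp (Suc (n * 2)) (poly q x) = poly q x * flat_exp (Suc (Suc (n * 2))) (poly q x)"
      "flat_exp (n * 2) (poly q x) = (poly q x)\<^sup>2 * flat_exp (Suc (Suc (n * 2))) (poly q x)"
      using flat_exp_mult[of "poly q x" 1 "n * 2 + 1"] flat_exp_mult[of "poly q x" 2 "n * 2"] by simp_all
    show ?thesis
      by (rule DERIV_cong[OF DERIV_mult[OF poly_DERIV d]])
        (simp add: e P(2) algebra_simps power2_eq_square)
  qed
  then show ?thesis
    unfolding smooth_real_def
    by (intro exI[of _ "\<lambda>n t. poly (P n) t * flat_exp (2 * n) (poly q t)"]) (simp add: P(1))
qed

text \<open>The quadratic is positive exactly between \<open>a\<close> and \<open>b\<close>.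
  Increasing \<open>k\<close> pushes the values there up to 1, so the bumps converge to the
  indicator of the open interval.\<close>

definition bump :: "real \<Rightarrow> real \<Rightarrow> nat \<Rightarrow> real \<Rightarrow> real" where
  "bump a b k t = flat_exp 0 (real k * ((t - a) * (b - t)))"

lemma smooth_real_bump: "smooth_real (bump a b k)"
proof -
  have "bump a b k = (\<lambda>t. flat_exp 0 (poly (smult (real k) ([:-a, 1:] * [:b, -1:])) t))"
    by (auto simp: bump_def algebra_simps)
  then show ?thesis using smooth_real_flat_exp_poly by metis
qed

lemma bump_nonneg: "0 \<le> bump a b k t" and bump_le_1: "bump a b k t \<le> 1"
  by (simp_all add: bump_def flat_exp_def)

lemma bump_outside:
  assumes "a \<le> b" "t \<notin> {a<..<b}"
  shows "bump a b k t = 0"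
proof -
  have "(t - a) * (b - t) \<le> 0"
    using assms by (auto simp: mult_le_0_iff)
  then have "real k * ((t - a) * (b - t)) \<le> 0" by (simp add: mult_le_0_iff)
  then show ?thesis by (simp add: bump_def flat_exp_def)
qed

lemma bump_tendsto:
  assumes "a \<le> b"
  shows "(\<lambda>k. bump a b k t) \<longlonglongrightarrow> indicator {a<..<b} t"
proof (cases "t \<in> {a<..<b}")
  case True
  define c where "c = (t - a) * (b - t)"
  have c: "c > 0" using True by (simp add: c_def)
  have "(\<lambda>k. exp (- (1 / c) * inverse (real k))) \<longlonglongrightarrow> exp (- (1 / c) * 0)"
    by (intro tendsto_intros LIMSEQ_inverse_real_of_nat lim_inverse_n)
  moreover have b: "bump a b k t = flat_exp 0 (real k * c)" for k
    by (simp add: bump_def c_def)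
  have "\<forall>\<^sub>F k in sequentially. exp (- (1 / c) * inverse (real k)) = bump a b k t"
    using eventually_gt_at_top[of 0]
    by eventually_elim (use c in \<open>simp add: b flat_exp_def field_simps\<close>)
  ultimately show ?thesis using True by (auto intro: Lim_transform_eventually)
qed (simp add: bump_outside[OF assms])

section \<open>Products of bumps as test functions\<close>

lemma partial_deriv_eq:
  "(f has_derivative f') (at x) \<Longrightarrow> partial_deriv i f x = f' (axis i 1)"
  unfolding partial_deriv_def by (metis frechet_derivative_at)

lemma has_derivative_partial_deriv:
  fixes f :: "real^'n \<Rightarrow> real"
  assumes "f differentiable at x"
  shows "(f has_derivative (\<lambda>h. \<Sum>i\<in>UNIV. h $ i * partial_deriv i f x)) (at x)"
proof -
  have d: "(f has_derivative frechet_derivative f (at x)) (at x)"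
    using assms by (simp add: frechet_derivative_works)
  then have lin: "linear (frechet_derivative f (at x))"
    by (rule has_derivative_linear)
  have "frechet_derivative f (at x) h = (\<Sum>i\<in>UNIV. h $ i * partial_deriv i f x)" for h
  proof -
    have "h = (\<Sum>i\<in>UNIV. (h $ i) *\<^sub>R axis i 1)"
      using basis_expansion[of h] by (simp add: scalar_mult_eq_scaleR)
    then have "frechet_derivative f (at x) h = frechet_derivative f (at x) (\<Sum>i\<in>UNIV. (h $ i) *\<^sub>R axis i 1)"
      by simp
    also have "\<dots> = (\<Sum>i\<in>UNIV. h $ i * partial_deriv i f x)"
      by (simp add: linear_sum[OF lin] linear_scale[OF lin] partial_deriv_def)
    finally show ?thesis .
  qed
  then have "frechet_derivative f (at x) = (\<lambda>h. \<Sum>i\<in>UNIV. h $ i * partial_deriv i f x)" ..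
  with d show ?thesis by simp
qed

lemma has_derivative_prod_coordinates:
  fixes f :: "'n::finite \<Rightarrow> real \<Rightarrow> real"
  assumes "\<And>j. (f j has_real_derivative f' j) (at (x $ j))"
  shows "((\<lambda>x. \<Prod>j\<in>UNIV. f j (x $ j)) has_derivative
    (\<lambda>h. \<Sum>i\<in>UNIV. f' i * h $ i * (\<Prod>j\<in>UNIV - {i}. f j (x $ j)))) (at x)"
proof (rule has_derivative_prod)
  fix j
  have "(f j has_derivative (*) (f' j)) (at (x $ j))"
    using assms by (simp add: has_field_derivative_def)
  from has_derivative_compose[OF bounded_linear_imp_has_derivative[OF bounded_linear_vec_nth] this]
  show "((\<lambda>x. f j (x $ j)) has_derivative (\<lambda>h. f' j * h $ j)) (at x)" .
qed

lemma partial_deriv_prod_coordinates: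
  fixes f :: "'n::finite \<Rightarrow> real \<Rightarrow> real"
  assumes "\<And>j. (f j has_real_derivative f' j) (at (x $ j))"
  shows "partial_deriv i (\<lambda>x. \<Prod>j\<in>UNIV. f j (x $ j)) x = f' i * (\<Prod>j\<in>UNIV - {i}. f j (x $ j))"
proof -
  have "partial_deriv i (\<lambda>x. \<Prod>j\<in>UNIV. f j (x $ j)) x
      = (\<Sum>k\<in>UNIV. if k = i then f' k * (\<Prod>j\<in>UNIV - {k}. f j (x $ j)) else 0)"
    unfolding partial_deriv_eq[OF has_derivative_prod_coordinates[OF assms]]
    by (intro sum.cong) (auto simp: axis_def)
  then show ?thesis by simp
qed

text \<open>The family of products with arbitrary orders \<open>m j\<close> is closed under partial
  derivatives: the \<open>i\<close>-th one raises \<open>m i\<close> by 1. The induction therefore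
  runs over all \<open>m\<close> at once.\<close>

lemma C_k_prod_coordinates:
  fixes F :: "'n::finite \<Rightarrow> nat \<Rightarrow> real \<Rightarrow> real"
  assumes F: "\<And>j n t. (F j n has_real_derivative F j (Suc n) t) (at t)"
  shows "C_k k (\<lambda>x. \<Prod>j\<in>UNIV. F j (m j) (x $ j))"
proof (induction k arbitrary: m)
  case 0
  show ?case
    using has_derivative_prod_coordinates[of "\<lambda>j. F j (m j)", OF F]
    by (auto simp: continuous_on_eq_continuous_at intro: has_derivative_continuous)
next
  case (Suc k)
  have "partial_deriv i (\<lambda>x. \<Prod>j\<in>UNIV. F j (m j) (x $ j))
      = (\<lambda>x. \<Prod>j\<in>UNIV. F j ((m(i := Suc (m i))) j) (x $ j))" for i
  proof
    fix x
    have "(\<Prod>j\<in>UNIV. F j ((m(i := Suc (m i))) j) (x $ j))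
        = F i (Suc (m i)) (x $ i) * (\<Prod>j\<in>UNIV - {i}. F j (m j) (x $ j))"
      by (subst prod.remove[of _ i]) (auto intro!: prod.cong)
    then show "partial_deriv i (\<lambda>x. \<Prod>j\<in>UNIV. F j (m j) (x $ j)) x
        = (\<Prod>j\<in>UNIV. F j ((m(i := Suc (m i))) j) (x $ j))"
      using partial_deriv_prod_coordinates[of "\<lambda>j. F j (m j)", OF F] by simp
  qed
  moreover have "(\<lambda>x. \<Prod>j\<in>UNIV. F j (m j) (x $ j)) differentiable at x" for x
    using has_derivative_prod_coordinates[of "\<lambda>j. F j (m j)", OF F] unfolding differentiable_def by blast
  ultimately show ?case using Suc.IH by simp
qed

definition product_bump :: "(real^'n \<Rightarrow> real) \<Rightarrow> bool" where
  "product_bump \<phi> \<longleftrightarrow> (\<exists>f a b. (\<forall>j. smooth_real (f j)) \<and>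
     (\<forall>j t. f j t \<noteq> 0 \<longrightarrow> t \<in> {a $ j..b $ j}) \<and> \<phi> = (\<lambda>x. \<Prod>j\<in>UNIV. f j (x $ j)))"

lemma test_function_product_bump:
  fixes \<phi> :: "real^'n \<Rightarrow> real"
  assumes "product_bump \<phi>"
  shows "test_function \<phi>"
proof -
  obtain f and a b :: "real^'n" where f: "\<And>j. smooth_real (f j)" "\<And>j t. f j t \<noteq> 0 \<Longrightarrow> t \<in> {a $ j..b $ j}"
    and \<phi>: "\<phi> = (\<lambda>x. \<Prod>j\<in>UNIV. f j (x $ j))"
    using assms unfolding product_bump_def by blast
  obtain F where F: "\<And>j. F j 0 = f j" "\<And>j n x. (F j n has_real_derivative F j (Suc n) x) (at x)"
    using f(1) unfolding smooth_real_def by metis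
  have "C_k k \<phi>" for k
    using C_k_prod_coordinates[of F k "\<lambda>_. 0", OF F(2)] by (simp add: F(1) \<phi>)
  moreover have "{x. \<phi> x \<noteq> 0} \<subseteq> cbox a b"
    using f(2) by (auto simp: \<phi> mem_box_cart)
  then have "compact (closure {x. \<phi> x \<noteq> 0})"
    by (meson bounded_cbox bounded_subset compact_closure)
  ultimately show ?thesis by (simp add: test_function_def)
qed

lemma test_function_continuous:
  fixes \<phi> :: "real^'n \<Rightarrow> real"
  assumes "test_function \<phi>"
  shows "\<phi> differentiable at x" "continuous_on UNIV \<phi>" "continuous_on UNIV (partial_deriv i \<phi>)"
proof -
  have 1: "C_k 0 \<phi>" and 2: "C_k (Suc 0) \<phi>" using assms unfolding test_function_def by blast+
  then show "\<phi> differentiable at x" "continuous_on UNIV \<phi>" "continuous_on UNIV (partial_deriv i \<phi>)"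
    by simp_all
qed

lemma test_function_support:
  fixes \<phi> :: "real^'n \<Rightarrow> real"
  assumes "test_function \<phi>"
  obtains K where "compact K" "\<And>x. x \<notin> K \<Longrightarrow> \<phi> x = 0" "\<And>i x. x \<notin> K \<Longrightarrow> partial_deriv i \<phi> x = 0"
proof
  let ?K = "closure {x. \<phi> x \<noteq> 0}"
  show "compact ?K" using assms by (simp add: test_function_def)
  show z: "\<phi> x = 0" if "x \<notin> ?K" for x using that closure_subset[of "{x. \<phi> x \<noteq> 0}"] by auto
  show "partial_deriv i \<phi> x = 0" if "x \<notin> ?K" for i x
  proof -
    have "((\<lambda>_. 0) has_derivative (\<lambda>_. 0)) (at x)" by simp
    then have "(\<phi> has_derivative (\<lambda>_. 0)) (at x)"
    proof (rule has_derivative_transform_within_open)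
      show "open (- ?K)" "x \<in> - ?K" using that by auto
      show "0 = \<phi> y" if "y \<in> - ?K" for y using z[of y] that by simp
    qed
    then show ?thesis by (simp add: partial_deriv_eq)
  qed
qed

section \<open>Local integrability and pairing with test functions\<close>

text \<open>Truncations to growing balls are integrable, hence measurable, and converge
  pointwise.\<close>

lemma locally_integrable_measurable:
  assumes "locally_integrable g"
  shows "g \<in> borel_measurable borel"
proof (rule borel_measurable_LIMSEQ_real)
  fix n
  show "(\<lambda>x. indicator (cball 0 (real n)) x * g x) \<in> borel_measurable borel"
  proof -
    have "set_integrable lborel (cball 0 (real n)) g"
      using assms by (simp add: locally_integrable_def)
    then show ?thesis
      using borel_measurable_integrable[of lborel "\<lambda>x. indicator (cball 0 (real n)) x * g x"]
      by (simp add: set_integrable_def)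
  qed
next
  fix x
  have "\<forall>\<^sub>F n in sequentially. indicator (cball 0 (real n)) x * g x = g x"
    using eventually_ge_at_top[of "nat \<lceil>norm x\<rceil>"]
    by eventually_elim (simp add: indicator_def nat_ceiling_le_eq)
  then show "(\<lambda>n. indicator (cball 0 (real n)) x * g x) \<longlonglongrightarrow> g x"
    by (rule tendsto_eventually)
qed

lemma integrable_mult_compact_support:
  assumes g: "locally_integrable g" and \<psi>: "continuous_on UNIV \<psi>"
    and K: "compact K" "\<And>x. x \<notin> K \<Longrightarrow> \<psi> x = 0"
  shows "integrable lborel (\<lambda>x. g x * \<psi> x)"
proof -
  have "bounded (\<psi> ` K)"
    by (intro compact_imp_bounded compact_continuous_image K continuous_on_subset[OF \<psi>]) auto
  then obtain B where B: "\<And>x. x \<in> K \<Longrightarrow> norm (\<psi> x) \<le> B"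
    unfolding bounded_iff by blast
  have [measurable]: "\<psi> \<in> borel_measurable borel" "g \<in> borel_measurable borel"
    using \<psi> g by (auto intro: borel_measurable_continuous_onI locally_integrable_measurable)
  have "integrable lborel (\<lambda>x. B * (indicator K x * g x))"
    using g K(1) unfolding locally_integrable_def set_integrable_def by simp
  then show ?thesis
  proof (rule Bochner_Integration.integrable_bound)
    show "AE x in lborel. norm (g x * \<psi> x) \<le> norm (B * (indicator K x * g x))"
    proof (intro AE_I2)
      fix x
      show "norm (g x * \<psi> x) \<le> norm (B * (indicator K x * g x))"
      proof (cases "x \<in> K")
        case True
        then have "\<bar>\<psi> x\<bar> \<le> \<bar>B\<bar>" using B[OF True] by simp
        then show ?thesis using True by (auto simp: abs_mult mult.commute intro: mult_right_mono)
      qed (simp add: K(2))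
    qed
  qed simp
qed

lemma integrable_mult_test_function:
  assumes "locally_integrable g" "test_function \<phi>"
  shows "integrable lborel (\<lambda>x. g x * \<phi> x)" "integrable lborel (\<lambda>x. g x * partial_deriv i \<phi> x)"
proof -
  obtain K where K: "compact K" "\<And>x. x \<notin> K \<Longrightarrow> \<phi> x = 0" "\<And>i x. x \<notin> K \<Longrightarrow> partial_deriv i \<phi> x = 0"
    using test_function_support[OF assms(2)] by blast
  show "integrable lborel (\<lambda>x. g x * \<phi> x)"
    by (rule integrable_mult_compact_support[OF assms(1) test_function_continuous(2)[OF assms(2)] K(1,2)])
  show "integrable lborel (\<lambda>x. g x * partial_deriv i \<phi> x)"
    by (rule integrable_mult_compact_support[OF assms(1) test_function_continuous(3)[OF assms(2)] K(1,3)])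
qed

section \<open>Product bumps determine measures and locally integrable functions\<close>

text \<open>Open boxes form an intersection-stable generator, and the indicator of a nonempty one is
  the limit of product bumps dominated by the indicator of the closed box, which has finite
  measure.\<close>

lemma measure_eqI_product_bump:
  fixes M N :: "(real^'n) measure"
  assumes [measurable_cong]: "sets M = sets borel" "sets N = sets borel"
    and fin: "\<And>a b. emeasure M (cbox a b) < \<infinity>" "\<And>a b. emeasure N (cbox a b) < \<infinity>"
    and eq: "\<And>\<phi>. product_bump \<phi> \<Longrightarrow> (\<integral>x. \<phi> x \<partial>M) = (\<integral>x. \<phi> x \<partial>N)"
  shows "M = N"
proof (rule measure_eqI_generator_eq)
  let ?E = "range (\<lambda>(a, b). box a b::(real^'n) set)"
  show "Int_stable ?E" by (auto simp: Int_stable_def box_Int_box)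
  show "?E \<subseteq> Pow UNIV" "sets M = sigma_sets UNIV ?E" "sets N = sigma_sets UNIV ?E"
    by (simp_all add: borel_eq_box assms)
  let ?A = "\<lambda>n::nat. box (- (real n *\<^sub>R One)) (real n *\<^sub>R One) :: (real^'n) set"
  show "range ?A \<subseteq> ?E" "(\<Union>i. ?A i) = UNIV" unfolding UN_box_eq_UNIV by auto
  have finb: "emeasure L (box a b) < \<infinity>" if "\<And>a b. emeasure L (cbox a b) < \<infinity>" "sets L = sets borel"
    for a b and L :: "(real^'n) measure"
    using that by (intro le_less_trans[OF emeasure_mono[OF box_subset_cbox] that(1)]) simp
  show "emeasure M (?A i) \<noteq> \<infinity>" for i by (intro less_imp_neq finb fin(1) assms(1))
  show "emeasure M X = emeasure N X" if "X \<in> ?E" for X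
  proof -
    obtain a b where X: "X = box a b" using \<open>X \<in> ?E\<close> by auto
    show ?thesis
    proof (cases "\<forall>j. a $ j < b $ j")
      case False
      then have "X = {}" unfolding X by (auto simp: interval_eq_empty_cart not_less)
      then show ?thesis by simp
    next
      case ab: True
      define \<phi> where "\<phi> k x = (\<Prod>j\<in>UNIV. bump (a $ j) (b $ j) k (x $ j))" for k and x :: "real^'n"
      have out: "bump (a $ j) (b $ j) k t = 0" if "t \<notin> {a $ j..b $ j}" for j k t
      proof (rule bump_outside)
        show "a $ j \<le> b $ j" using ab by (simp add: less_imp_le)
        show "t \<notin> {a $ j<..<b $ j}" using that by auto
      qed
      have pb: "product_bump (\<phi> k)" for k
        unfolding product_bump_def \<phi>_def
      proof (rule exI[of _ "\<lambda>j. bump (a $ j) (b $ j) k"], rule exI[of _ a], rule exI[of _ b], intro conjI allI impI)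
        show "t \<in> {a $ j..b $ j}" if "bump (a $ j) (b $ j) k t \<noteq> 0" for j t
          using that out[of t j k] by blast
      qed (simp_all add: smooth_real_bump)
      have lim: "(\<lambda>k. \<phi> k x) \<longlonglongrightarrow> indicator X x" for x
      proof -
        have "(\<lambda>k. \<phi> k x) \<longlonglongrightarrow> (\<Prod>j\<in>UNIV. indicator {a $ j<..<b $ j} (x $ j))"
          unfolding \<phi>_def using ab by (intro tendsto_prod bump_tendsto) (simp add: less_imp_le)
        also have "(\<Prod>j\<in>UNIV. indicator {a $ j<..<b $ j} (x $ j)) = (indicator X x :: real)"
          by (auto simp: X indicator_def mem_box_cart)
        finally show ?thesis .
      qed
      have le: "norm (\<phi> k x) \<le> indicator (cbox a b) x" for k x
      proof (cases "x \<in> cbox a b")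
        case True
        have "\<bar>\<phi> k x\<bar> = (\<Prod>j\<in>UNIV. \<bar>bump (a $ j) (b $ j) k (x $ j)\<bar>)"
          unfolding \<phi>_def by (rule abs_prod)
        also have "\<dots> \<le> 1" using bump_nonneg bump_le_1 by (intro prod_le_1) auto
        finally show ?thesis using True by simp
      next
        case False
        then obtain j where "x $ j \<notin> {a $ j..b $ j}" by (auto simp: mem_box_cart)
        then have "\<phi> k x = 0" unfolding \<phi>_def using out[of "x $ j" j k] by (intro prod_zero) auto
        then show ?thesis by simp
      qed
      have conv: "(\<lambda>k. \<integral>x. \<phi> k x \<partial>L) \<longlonglongrightarrow> measure L X"
        if L: "\<And>a b. emeasure L (cbox a b) < \<infinity>" "sets L = sets borel" for L
      proof -
        have "(\<lambda>k. \<integral>x. \<phi> k x \<partial>L) \<longlonglongrightarrow> (\<integral>x. indicator X x \<partial>L)"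
        proof (rule integral_dominated_convergence)
          show "integrable L (indicator (cbox a b) :: _ \<Rightarrow> real)"
            using L by simp
          show "\<phi> k \<in> borel_measurable L" for k
            using test_function_continuous(2)[OF test_function_product_bump[OF pb]] L(2)
            by (auto intro: borel_measurable_continuous_onI cong: measurable_cong_sets)
        qed (use lim le L X in \<open>auto cong: measurable_cong_sets\<close>)
        also have "(\<integral>x. indicator X x \<partial>L) = measure L X"
          using L sets_eq_imp_space_eq[OF L(2)] by simp
        finally show ?thesis .
      qed
      have "measure M X = measure N X"
        using conv[OF fin(1) assms(1)] conv[OF fin(2) assms(2)] eq[OF pb] LIMSEQ_unique by fastforce
      then show ?thesis
        using less_imp_neq[OF finb[OF fin(1) assms(1), of a b]]
          less_imp_neq[OF finb[OF fin(2) assms(2), of a b]] X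
        by (simp add: emeasure_eq_ennreal_measure)
    qed
  qed
qed

text \<open>The positive and the negative part of \<open>g\<close> are densities of two measures
  with the same integrals of product bumps. The measures coincide, so the two parts agree almost
  everywhere; as one of them is always 0, both are.\<close>

lemma fundamental_lemma_calculus_of_variations:
  fixes g :: "real^'n \<Rightarrow> real"
  assumes g: "locally_integrable g"
    and eq: "\<And>\<phi>. product_bump \<phi> \<Longrightarrow> (\<integral>x. g x * \<phi> x \<partial>lborel) = 0"
  shows "AE x in lborel. g x = 0"
proof -
  have [measurable]: "g \<in> borel_measurable borel" using g by (rule locally_integrable_measurable)
  \<comment> \<open>The sign \<open>s\<close> is 1 or -1 below, so one definition serves both parts
    of \<open>g\<close>.\<close>
  define D where "D s = density lborel (\<lambda>x. ennreal (max 0 (s * g x)))" for s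
  have fin: "emeasure (D s) (cbox a b) < \<infinity>" for s a b
  proof -
    have "emeasure (D s) (cbox a b) = (\<integral>\<^sup>+x. ennreal (max 0 (s * g x)) * indicator (cbox a b) x \<partial>lborel)"
      unfolding D_def by (rule emeasure_density) auto
    also have "\<dots> \<le> (\<integral>\<^sup>+x. ennreal (norm (s * (indicator (cbox a b) x * g x))) \<partial>lborel)"
      by (intro nn_integral_mono) (auto simp: indicator_def intro!: ennreal_leI)
    also have "\<dots> < \<infinity>"
    proof -
      have "integrable lborel (\<lambda>x. s * (indicator (cbox a b) x * g x))"
        using g unfolding locally_integrable_def set_integrable_def by simp
      then show ?thesis unfolding integrable_iff_bounded by (rule conjunct2)
    qed
    finally show ?thesis .
  qed
  have "D 1 = D (-1)"
  proof (rule measure_eqI_product_bump)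
    fix \<phi> :: "real^'n \<Rightarrow> real" assume \<phi>: "product_bump \<phi>"
    note t = test_function_product_bump[OF \<phi>]
    have [measurable]: "\<phi> \<in> borel_measurable borel"
      using test_function_continuous(2)[OF t] by (rule borel_measurable_continuous_onI)
    have i: "integrable lborel (\<lambda>x. max 0 (s * g x) * \<phi> x)" if "s = 1 \<or> s = -1" for s
      using integrable_mult_test_function(1)[OF g t]
      by (rule Bochner_Integration.integrable_bound)
        (use that in \<open>auto simp: abs_mult max_def intro!: AE_I2 mult_right_mono\<close>)
    have *: "(\<integral>x. \<phi> x \<partial>D s) = (\<integral>x. max 0 (s * g x) * \<phi> x \<partial>lborel)" for s
      unfolding D_def by (subst integral_density) auto
    have "(\<integral>x. \<phi> x \<partial>D 1) - (\<integral>x. \<phi> x \<partial>D (-1))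
        = (\<integral>x. max 0 (1 * g x) * \<phi> x - max 0 (-1 * g x) * \<phi> x \<partial>lborel)"
      unfolding * by (rule Bochner_Integration.integral_diff[symmetric]) (auto intro!: i[of 1, simplified] i[of "-1", simplified])
    also have "\<dots> = (\<integral>x. g x * \<phi> x \<partial>lborel)"
      by (intro Bochner_Integration.integral_cong) (auto simp: max_def)
    also have "\<dots> = 0" using eq \<phi> .
    finally show "(\<integral>x. \<phi> x \<partial>D 1) = (\<integral>x. \<phi> x \<partial>D (-1))" by simp
  qed (rule fin | simp add: D_def)+
  then have "AE x in lborel. ennreal (max 0 (1 * g x)) = ennreal (max 0 (-1 * g x))"
    unfolding D_def by (subst (asm) sigma_finite_measure.density_unique_iff[OF sigma_finite_lborel]) auto
  then show ?thesis
    by eventually_elim (auto simp: max_def split: if_splits)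
qed

lemma continuous_locally_integrable:
  fixes u :: "real^'n \<Rightarrow> real"
  shows "continuous_on UNIV u \<Longrightarrow> locally_integrable u"
  unfolding locally_integrable_def set_integrable_def
  by (intro allI impI borel_integrable_compact) (auto intro: continuous_on_subset)

text \<open>The zero set is closed and of full measure, hence everything.\<close>

lemma continuous_AE_zero:
  fixes u :: "real^'n \<Rightarrow> real"
  assumes "continuous_on UNIV u" "AE x in lborel. u x = 0"
  shows "u x = 0"
proof -
  have "closed {x. u x = 0}"
    using assms(1) by (intro closed_Collect_eq) auto
  then show ?thesis
    using mem_closed_if_AE_lebesgue[of "{x. u x = 0}" x] AE_completion[OF assms(2)] by simp
qed

section \<open>Weak partial derivatives\<close>

lemma locally_integrable_add:
  "locally_integrable f \<Longrightarrow> locally_integrable g \<Longrightarrow> locally_integrable (\<lambda>x. f x + g x)"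
  unfolding locally_integrable_def by (auto intro: set_integral_add)

lemma locally_integrable_scale:
  "locally_integrable f \<Longrightarrow> locally_integrable (\<lambda>x. c * f x)"
  unfolding locally_integrable_def by auto

lemma locally_integrable_diff:
  "locally_integrable f \<Longrightarrow> locally_integrable g \<Longrightarrow> locally_integrable (\<lambda>x. f x - g x)"
  unfolding locally_integrable_def by (auto intro: set_integral_diff)

lemma locally_integrable_sum:
  "(\<And>i. i \<in> I \<Longrightarrow> locally_integrable (f i)) \<Longrightarrow> locally_integrable (\<lambda>x. \<Sum>i\<in>I. f i x)"
proof (induction I rule: infinite_finite_induct)
  case (insert i I)
  then show ?case by (simp add: locally_integrable_add)
qed (simp_all add: locally_integrable_def set_integrable_def)

lemma has_weak_partial_lincomb:
  fixes u w :: "real^'n \<Rightarrow> real"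
  assumes u: "locally_integrable u" "has_weak_partial u i g"
    and w: "locally_integrable w" "has_weak_partial w i h"
  shows "has_weak_partial (\<lambda>x. a * u x + b * w x) i (\<lambda>x. a * g x + b * h x)"
  unfolding has_weak_partial_def
proof (intro conjI allI impI)
  have g: "locally_integrable g" and h: "locally_integrable h"
    using u w by (simp_all add: has_weak_partial_def)
  then show "locally_integrable (\<lambda>x. a * g x + b * h x)"
    by (intro locally_integrable_add locally_integrable_scale)
  fix \<phi> :: "real^'n \<Rightarrow> real" assume \<phi>: "test_function \<phi>"
  note i = integrable_mult_test_function[OF _ \<phi>]
  have "(\<integral>x. (a * u x + b * w x) * partial_deriv i \<phi> x \<partial>lborel)
      = (\<integral>x. a * (u x * partial_deriv i \<phi> x) + b * (w x * partial_deriv i \<phi> x) \<partial>lborel)"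
    by (simp add: algebra_simps)
  also have "\<dots> = a * (\<integral>x. u x * partial_deriv i \<phi> x \<partial>lborel) + b * (\<integral>x. w x * partial_deriv i \<phi> x \<partial>lborel)"
    using i(2)[OF u(1), of i] i(2)[OF w(1), of i] by simp
  also have "\<dots> = - (a * (\<integral>x. g x * \<phi> x \<partial>lborel) + b * (\<integral>x. h x * \<phi> x \<partial>lborel))"
    using u(2) w(2) \<phi> by (simp add: has_weak_partial_def)
  also have "a * (\<integral>x. g x * \<phi> x \<partial>lborel) + b * (\<integral>x. h x * \<phi> x \<partial>lborel)
      = (\<integral>x. a * (g x * \<phi> x) + b * (h x * \<phi> x) \<partial>lborel)"
    using i(1)[OF g] i(1)[OF h] by simp
  also have "\<dots> = (\<integral>x. (a * g x + b * h x) * \<phi> x \<partial>lborel)"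
    by (simp add: algebra_simps)
  finally show "(\<integral>x. (a * u x + b * w x) * partial_deriv i \<phi> x \<partial>lborel)
      = - (\<integral>x. (a * g x + b * h x) * \<phi> x \<partial>lborel)" .
qed

lemma has_weak_partial_unique:
  fixes u :: "real^'n \<Rightarrow> real"
  assumes "has_weak_partial u i g" "has_weak_partial u i h"
  shows "AE x in lborel. g x = h x"
proof -
  have li: "locally_integrable g" "locally_integrable h"
    using assms by (simp_all add: has_weak_partial_def)
  have "AE x in lborel. g x - h x = 0"
  proof (rule fundamental_lemma_calculus_of_variations)
    show "locally_integrable (\<lambda>x. g x - h x)" by (intro locally_integrable_diff li)
    fix \<phi> :: "real^'n \<Rightarrow> real" assume "product_bump \<phi>"
    then have \<phi>: "test_function \<phi>" by (rule test_function_product_bump)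
    have "(\<integral>x. g x * \<phi> x \<partial>lborel) = (\<integral>x. h x * \<phi> x \<partial>lborel)"
      using assms \<phi> unfolding has_weak_partial_def by force
    then show "(\<integral>x. (g x - h x) * \<phi> x \<partial>lborel) = 0"
      using integrable_mult_test_function(1)[OF li(1) \<phi>] integrable_mult_test_function(1)[OF li(2) \<phi>]
      by (simp add: left_diff_distrib)
  qed
  then show ?thesis by eventually_elim simp
qed

lemma has_weak_partial_weak_partial:
  "has_weak_partial u i g \<Longrightarrow> has_weak_partial u i (weak_partial u i)"
  unfolding weak_partial_def by (rule someI[of "has_weak_partial u i"])

lemma weak_partial_AE_eq:
  fixes u :: "real^'n \<Rightarrow> real"
  shows "has_weak_partial u i g \<Longrightarrow> AE x in lborel. weak_partial u i x = g x"
  using has_weak_partial_unique[OF has_weak_partial_weak_partial] .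

lemma weak_grad_AE_eq:
  fixes u :: "real^'n \<Rightarrow> real"
  assumes "\<And>i. has_weak_partial u i (\<lambda>x. G x $ i)"
  shows "AE x in lborel. weak_grad u x = G x"
proof -
  have "AE x in lborel. \<forall>i. weak_partial u i x = G x $ i"
    using weak_partial_AE_eq[OF assms] by (subst AE_all_countable) auto
  then show ?thesis
    by eventually_elim (simp add: weak_grad_def vec_eq_iff)
qed

text \<open>The increment \<open>\<phi>(x + h e\<^sub>i) - \<phi>(x)\<close> of a product is the \<open>i\<close>-th partial
  derivative of the product in which the \<open>i\<close>-th factor is replaced by the increment of its
  antiderivative; this is again a test function.\<close>

lemma product_bump_increment:
  fixes \<phi> :: "real^'n \<Rightarrow> real"
  assumes "product_bump \<phi>"
  obtains \<Phi> where "product_bump \<Phi>" "\<And>x. partial_deriv i \<Phi> x = \<phi> (x + h *\<^sub>R axis i 1) - \<phi> x"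
proof -
  obtain f and a b :: "real^'n" where f: "\<And>j. smooth_real (f j)" "\<And>j t. f j t \<noteq> 0 \<Longrightarrow> t \<in> {a $ j..b $ j}"
    and \<phi>: "\<phi> = (\<lambda>x. \<Prod>j\<in>UNIV. f j (x $ j))"
    using assms unfolding product_bump_def by blast
  have "\<exists>f'. \<forall>x. (f j has_real_derivative f' x) (at x)" for j
    using smooth_real_has_derivative[OF f(1)[of j]] by blast
  then obtain f' where f': "\<And>j x. (f j has_real_derivative f' j x) (at x)"
    by metis
  have "isCont (f i) x" for x using f' DERIV_isCont by blast
  then obtain G where G: "\<And>x. (G has_real_derivative f i x) (at x)"
    using einterval_antiderivative[of "-\<infinity>" \<infinity> "f i"] by (auto simp: has_real_derivative_iff_has_vector_derivative)
  define D where "D t = G (t + h) - G t" for t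
  have D': "(D has_real_derivative f i (t + h) - f i t) (at t)" for t
    unfolding D_def by (intro DERIV_diff G) (use G[of "t + h"] DERIV_shift in blast)
  have sD: "smooth_real D"
    unfolding D_def by (intro smooth_real_shift_diff smooth_real_antiderivative[OF f(1)[of i] G])
  \<comment> \<open>The antiderivative \<open>G\<close> need not have compact support, but its
    increment does: off the interval widened by \<open>\<bar>h\<bar>\<close>, the segment between
    \<open>t\<close> and \<open>t + h\<close> avoids the support of \<open>f i\<close>, and
    \<open>G\<close> is constant on it.\<close>
  have D0: "D t = 0" if t: "t \<notin> {a $ i - \<bar>h\<bar>..b $ i + \<bar>h\<bar>}" for t
  proof -
    define l where "l = min t (t + h)"
    define r where "r = max t (t + h)"
    have "f i s = 0" if "l \<le> s" "s \<le> r" for s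
    proof (rule ccontr)
      assume "f i s \<noteq> 0"
      from f(2)[OF this] have "a $ i \<le> s" "s \<le> b $ i" by auto
      with that t show False unfolding l_def r_def by (auto simp: min_def max_def split: if_splits)
    qed
    then have z: "(G has_real_derivative 0) (at s)" if "l \<le> s" "s \<le> r" for s
      using G[of s] that by simp
    have "G r = G l"
    proof (cases "l = r")
      case False
      then have "l < r" unfolding l_def r_def by (auto simp: min_def max_def split: if_splits)
      then show ?thesis
        using z by (intro DERIV_isconst_end) (auto intro!: continuous_at_imp_continuous_on DERIV_isCont)
    qed simp
    then show ?thesis unfolding D_def l_def r_def by (auto simp: min_def max_def split: if_splits)
  qed
  define F where "F j = (if j = i then D else f j)" for j
  define F' where "F' j t = (if j = i then f i (t + h) - f i t else f' j t)" for j t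
  have F': "(F j has_real_derivative F' j t) (at t)" for j t
    using D' f' by (simp add: F_def F'_def)
  define \<Phi> where "\<Phi> x = (\<Prod>j\<in>UNIV. F j (x $ j))" for x :: "real^'n"
  have "product_bump \<Phi>"
    unfolding product_bump_def
  proof (rule exI[of _ F], rule exI[of _ "\<chi> j. a $ j - \<bar>h\<bar>"], rule exI[of _ "\<chi> j. b $ j + \<bar>h\<bar>"],
      intro conjI allI impI)
    show "smooth_real (F j)" for j using f(1) sD by (simp add: F_def)
    show "t \<in> {(\<chi> j. a $ j - \<bar>h\<bar>) $ j..(\<chi> j. b $ j + \<bar>h\<bar>) $ j}" if "F j t \<noteq> 0" for j t
    proof (cases "j = i")
      case True
      then show ?thesis using that D0[of t] by (auto simp: F_def)
    next
      case False
      then have "t \<in> {a $ j..b $ j}" using that by (intro f(2)) (simp add: F_def)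
      then show ?thesis by auto
    qed
    show "\<Phi> = (\<lambda>x. \<Prod>j\<in>UNIV. F j (x $ j))" by (simp add: \<Phi>_def[abs_def])
  qed
  moreover have "partial_deriv i \<Phi> x = \<phi> (x + h *\<^sub>R axis i 1) - \<phi> x" for x
  proof -
    have R: "(\<Prod>j\<in>UNIV - {i}. g j) = (\<Prod>j\<in>UNIV - {i}. f j (x $ j))"
      if "\<And>j. j \<noteq> i \<Longrightarrow> g j = f j (x $ j)" for g
      using that by (intro prod.cong) auto
    have "partial_deriv i \<Phi> x = F' i (x $ i) * (\<Prod>j\<in>UNIV - {i}. F j (x $ j))"
      unfolding \<Phi>_def[abs_def] by (rule partial_deriv_prod_coordinates[OF F'])
    also have "\<dots> = (f i (x $ i + h) - f i (x $ i)) * (\<Prod>j\<in>UNIV - {i}. f j (x $ j))"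
      by (subst R) (auto simp: F_def F'_def)
    finally have 1: "partial_deriv i \<Phi> x = \<dots>" .
    have 2: "\<phi> x = f i (x $ i) * (\<Prod>j\<in>UNIV - {i}. f j (x $ j))"
      unfolding \<phi> by (rule prod.remove) auto
    have "\<phi> (x + h *\<^sub>R axis i 1) = f i ((x + h *\<^sub>R axis i 1) $ i)
        * (\<Prod>j\<in>UNIV - {i}. f j ((x + h *\<^sub>R axis i 1) $ j))"
      unfolding \<phi> by (rule prod.remove) auto
    also have "\<dots> = f i (x $ i + h) * (\<Prod>j\<in>UNIV - {i}. f j (x $ j))"
      by (subst R) (auto simp: axis_def)
    finally show ?thesis using 1 2 by (simp add: algebra_simps)
  qed
  ultimately show ?thesis by (rule that)
qed

lemma integral_lborel_translate:
  fixes f :: "'a::euclidean_space \<Rightarrow> real"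
  assumes [measurable]: "f \<in> borel_measurable borel"
  shows "(\<integral>x. f (x + c) \<partial>lborel) = (\<integral>x. f x \<partial>lborel)"
  by (subst lborel_distr_plus[of c, symmetric]) (simp add: integral_distr add.commute)

text \<open>After a translation in the integral, testing an increment of \<open>u\<close> along an
  axis with a product bump pairs \<open>u\<close> with an increment of that bump, that is, with a
  partial derivative of another product bump; this pairing is 0. Hence \<open>u\<close> is invariant
  under translations along every axis.\<close>

lemma weak_partials_zero_imp_const:
  fixes u :: "real^'n \<Rightarrow> real"
  assumes u: "continuous_on UNIV u"
    and wp: "\<And>i. has_weak_partial u i (g i)" and g: "\<And>i. AE x in lborel. g i x = 0"
  shows "u x = u 0"
proof -
  have li: "locally_integrable u" using u by (rule continuous_locally_integrable)
  have shift: "u (x - h *\<^sub>R axis i 1) = u x" for x h i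
  proof -
    have c: "continuous_on UNIV (\<lambda>x. u (x - h *\<^sub>R axis i 1))"
      by (intro continuous_on_compose2[OF u] continuous_intros) auto
    have cd: "continuous_on UNIV (\<lambda>x. u (x - h *\<^sub>R axis i 1) - u x)"
      by (intro continuous_on_diff c u)
    have "AE x in lborel. u (x - h *\<^sub>R axis i 1) - u x = 0"
    proof (rule fundamental_lemma_calculus_of_variations)
      show "locally_integrable (\<lambda>x. u (x - h *\<^sub>R axis i 1) - u x)"
        using cd by (rule continuous_locally_integrable)
      fix \<phi> :: "real^'n \<Rightarrow> real" assume "product_bump \<phi>"
      then obtain \<Phi> where \<Phi>: "product_bump \<Phi>"
        "\<And>x. partial_deriv i \<Phi> x = \<phi> (x + h *\<^sub>R axis i 1) - \<phi> x"
        using product_bump_increment by metis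
      have \<phi>: "test_function \<phi>" by (rule test_function_product_bump) fact
      note t\<Phi> = test_function_product_bump[OF \<Phi>(1)]
      have [measurable]: "\<phi> \<in> borel_measurable borel" "u \<in> borel_measurable borel"
        using test_function_continuous(2)[OF \<phi>] u by (auto intro: borel_measurable_continuous_onI)
      have i1: "integrable lborel (\<lambda>x. u x * \<phi> x)"
        by (rule integrable_mult_test_function(1)[OF li \<phi>])
      have i2: "integrable lborel (\<lambda>x. u (x - h *\<^sub>R axis i 1) * \<phi> x)"
        by (rule integrable_mult_test_function(1)[OF continuous_locally_integrable[OF c] \<phi>])
      have i3: "integrable lborel (\<lambda>x. u x * partial_deriv i \<Phi> x)"
        by (rule integrable_mult_test_function(2)[OF li t\<Phi>])
      have "(\<integral>x. g i x * \<Phi> x \<partial>lborel) = (\<integral>x. 0 \<partial>(lborel :: (real^'n) measure))"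
      proof (rule integral_cong_AE)
        have "g i \<in> borel_measurable borel"
          using wp by (auto simp: has_weak_partial_def intro: locally_integrable_measurable)
        moreover have "\<Phi> \<in> borel_measurable borel"
          using test_function_continuous(2)[OF t\<Phi>] by (rule borel_measurable_continuous_onI)
        ultimately show "(\<lambda>x. g i x * \<Phi> x) \<in> borel_measurable lborel" by simp
        show "AE x in lborel. g i x * \<Phi> x = 0" using g[of i] by eventually_elim simp
      qed simp
      then have "(\<integral>x. u x * partial_deriv i \<Phi> x \<partial>lborel) = 0"
        using wp[of i] t\<Phi> by (simp add: has_weak_partial_def)
      then have "(\<integral>x. u x * partial_deriv i \<Phi> x + u x * \<phi> x \<partial>lborel) = (\<integral>x. u x * \<phi> x \<partial>lborel)"
        using i1 i3 by simp
      also have "(\<lambda>x. u x * partial_deriv i \<Phi> x + u x * \<phi> x) = (\<lambda>x. u x * \<phi> (x + h *\<^sub>R axis i 1))"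
        by (simp add: \<Phi>(2) algebra_simps)
      also have "(\<integral>x. u x * \<phi> (x + h *\<^sub>R axis i 1) \<partial>lborel) = (\<integral>x. u (x - h *\<^sub>R axis i 1) * \<phi> x \<partial>lborel)"
        using integral_lborel_translate[of "\<lambda>x. u (x - h *\<^sub>R axis i 1) * \<phi> x" "h *\<^sub>R axis i 1"] by simp
      finally show "(\<integral>x. (u (x - h *\<^sub>R axis i 1) - u x) * \<phi> x \<partial>lborel) = 0"
        using i1 i2 by (simp add: left_diff_distrib)
    qed
    from continuous_AE_zero[OF cd this, of x] show ?thesis by simp
  qed
  \<comment> \<open>The coordinates of \<open>x\<close> are removed one axis at a time; over the
    full index set this ends at 0.\<close>
  have "u (x - (\<Sum>i\<in>S. (x $ i) *\<^sub>R axis i 1)) = u x" if "finite S" for S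
    using that
  proof (induction S rule: finite_induct)
    case (insert i S)
    have "x - (\<Sum>i\<in>insert i S. (x $ i) *\<^sub>R axis i 1)
        = (x - (\<Sum>i\<in>S. (x $ i) *\<^sub>R axis i 1)) - (x $ i) *\<^sub>R axis i 1"
      using insert by (simp add: algebra_simps)
    then show ?case using insert.IH by (simp only: shift)
  qed simp
  from this[of UNIV] show ?thesis
    using basis_expansion[of x] by (simp add: scalar_mult_eq_scaleR)
qed

section \<open>Isometries and the homogeneous Sobolev space\<close>

lemma C_k_add: "C_k k f \<Longrightarrow> C_k k g \<Longrightarrow> C_k k (\<lambda>x. f x + g x)"
proof (induction k arbitrary: f g)
  case (Suc k)
  have d: "f differentiable at x" "g differentiable at x" for x using Suc.prems by simp_all
  have "partial_deriv i (\<lambda>x. f x + g x) = (\<lambda>x. partial_deriv i f x + partial_deriv i g x)" for i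
  proof
    fix x
    have "(f has_derivative frechet_derivative f (at x)) (at x)" "(g has_derivative frechet_derivative g (at x)) (at x)"
      using d[of x] frechet_derivative_works by blast+
    from partial_deriv_eq[OF has_derivative_add[OF this]]
    show "partial_deriv i (\<lambda>x. f x + g x) x = partial_deriv i f x + partial_deriv i g x"
      by (simp add: partial_deriv_def)
  qed
  with Suc d show ?case by simp
qed (simp add: continuous_on_add)

lemma C_k_scale: "C_k k f \<Longrightarrow> C_k k (\<lambda>x. c * f x)"
proof (induction k arbitrary: f)
  case (Suc k)
  have d: "f differentiable at x" for x using Suc.prems by simp
  have "partial_deriv i (\<lambda>x. c * f x) = (\<lambda>x. c * partial_deriv i f x)" for i
  proof
    fix x
    have "(f has_derivative frechet_derivative f (at x)) (at x)"
      using d[of x] frechet_derivative_works by blast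
    from partial_deriv_eq[OF has_derivative_mult_right[OF this]]
    show "partial_deriv i (\<lambda>x. c * f x) x = c * partial_deriv i f x"
      by (simp add: partial_deriv_def)
  qed
  with Suc d show ?case by simp
qed (simp add: continuous_on_mult_left)

lemma C_k_const: "C_k k (\<lambda>x. c)"
proof (induction k arbitrary: c)
  case (Suc k)
  have "partial_deriv i (\<lambda>x::real^'a. c) = (\<lambda>x. 0)" for i
    by (simp add: partial_deriv_def fun_eq_iff)
  with Suc show ?case by simp
qed simp

lemma C_k_sum: "(\<And>j. j \<in> J \<Longrightarrow> C_k k (f j)) \<Longrightarrow> C_k k (\<lambda>x. \<Sum>j\<in>J. f j x)"
  by (induction J rule: infinite_finite_induct) (simp_all add: C_k_const C_k_add)

lemma partial_deriv_compose_affine: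
  fixes f :: "real^'n \<Rightarrow> real"
  assumes Q: "linear Q" and f: "f differentiable at (Q x + z)"
  shows "(\<lambda>x. f (Q x + z)) differentiable at x"
    and "partial_deriv i (\<lambda>x. f (Q x + z)) x
      = (\<Sum>j\<in>UNIV. Q (axis i 1) $ j * partial_deriv j f (Q x + z))"
proof -
  have "((\<lambda>x. Q x + z) has_derivative Q) (at x)"
    using has_derivative_add_const[OF bounded_linear_imp_has_derivative] Q
    by (simp add: linear_conv_bounded_linear)
  from has_derivative_compose[OF this has_derivative_partial_deriv[OF f]]
  have d: "((\<lambda>x. f (Q x + z)) has_derivative
    (\<lambda>h. \<Sum>j\<in>UNIV. Q h $ j * partial_deriv j f (Q x + z))) (at x)" .
  from d show "(\<lambda>x. f (Q x + z)) differentiable at x"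
    unfolding differentiable_def by blast
  from partial_deriv_eq[OF d] show "partial_deriv i (\<lambda>x. f (Q x + z)) x
      = (\<Sum>j\<in>UNIV. Q (axis i 1) $ j * partial_deriv j f (Q x + z))" .
qed

text \<open>Partial derivatives of the composition are combinations, with constant coefficients, of
  partial derivatives composed with the same affine map, so the induction hypothesis for all
  \<open>f\<close> applies.\<close>

lemma C_k_compose_affine:
  assumes Q: "linear Q"
  shows "C_k k f \<Longrightarrow> C_k k (\<lambda>x. f (Q x + z))"
proof (induction k arbitrary: f)
  case 0
  have "continuous_on UNIV (\<lambda>x. Q x + z)"
    using Q by (intro continuous_intros linear_continuous_on) (simp add: linear_conv_bounded_linear)
  with 0 show ?case by (auto intro: continuous_on_compose2)
next
  case (Suc k)
  have d: "f differentiable at x" for x using Suc.prems by simp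
  have "partial_deriv i (\<lambda>x. f (Q x + z))
      = (\<lambda>x. \<Sum>j\<in>UNIV. Q (axis i 1) $ j * partial_deriv j f (Q x + z))" for i
    using partial_deriv_compose_affine(2)[OF Q d] by blast
  then show ?case
    using Suc partial_deriv_compose_affine(1)[OF Q d] by (auto intro!: C_k_sum C_k_scale)
qed

lemma orthogonal_transformation_bounded_linear:
  "orthogonal_transformation (Q :: 'a::euclidean_space \<Rightarrow> 'a) \<Longrightarrow> bounded_linear Q"
  using orthogonal_transformation_linear linear_conv_bounded_linear by blast

lemma continuous_on_isometry:
  fixes Q :: "'a::euclidean_space \<Rightarrow> 'a"
  assumes "orthogonal_transformation Q"
  shows "continuous_on S (\<lambda>x. Q x + z)"
  using assms by (intro continuous_intros linear_continuous_on orthogonal_transformation_bounded_linear)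

lemma test_function_compose_isometry:
  fixes \<phi> :: "real^'n \<Rightarrow> real" and Q :: "real^'n \<Rightarrow> real^'n"
  assumes Q: "orthogonal_transformation Q" and \<phi>: "test_function \<phi>"
  shows "test_function (\<lambda>x. \<phi> (Q x + z))"
proof -
  have "bounded {x. \<phi> x \<noteq> 0}"
    using \<phi> unfolding test_function_def by (meson bounded_subset closure_subset compact_imp_bounded)
  then obtain B where B: "\<And>x. \<phi> x \<noteq> 0 \<Longrightarrow> norm x \<le> B" unfolding bounded_iff by blast
  have "norm x \<le> B + norm z" if "\<phi> (Q x + z) \<noteq> 0" for x
    using B[OF that] norm_triangle_ineq4[of "Q x + z" z] orthogonal_transformation_norm[OF Q, of x] by simp
  then have "bounded {x. \<phi> (Q x + z) \<noteq> 0}" unfolding bounded_iff by blast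
  then show ?thesis
    using \<phi> C_k_compose_affine[OF orthogonal_transformation_linear[OF Q]]
    unfolding test_function_def by (auto simp: compact_closure)
qed

lemma
  fixes Q :: "'a::euclidean_space \<Rightarrow> 'a" and f :: "'a \<Rightarrow> real"
  assumes Q: "orthogonal_transformation Q" and [measurable]: "f \<in> borel_measurable borel"
  shows integral_lborel_isometry: "(\<integral>x. f (Q x + z) \<partial>lborel) = (\<integral>x. f x \<partial>lborel)"
    and integrable_lborel_isometry: "integrable lborel (\<lambda>x. f (Q x + z)) = integrable lborel f"
proof -
  have [measurable]: "(\<lambda>x. Q x + z) \<in> borel_measurable borel"
    by (rule borel_measurable_continuous_onI[OF continuous_on_isometry[OF Q]])
  show "(\<integral>x. f (Q x + z) \<partial>lborel) = (\<integral>x. f x \<partial>lborel)"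
    using integral_distr[of "\<lambda>x. Q x + z" lborel borel f] by (simp add: distr_lborel_isometry[OF Q])
  show "integrable lborel (\<lambda>x. f (Q x + z)) = integrable lborel f"
    using integrable_distr_eq[of "\<lambda>x. Q x + z" lborel borel f] by (simp add: distr_lborel_isometry[OF Q])
qed

lemma orthogonal_transformation_inverse_isometry:
  fixes Q :: "'a::euclidean_space \<Rightarrow> 'a"
  assumes "orthogonal_transformation Q"
  obtains Q' where "orthogonal_transformation Q'" "\<And>x. Q (Q' x) = x" "\<And>x. Q' (Q x) = x"
  using orthogonal_transformation_inv[OF assms] orthogonal_transformation_bij[OF assms]
  by (metis bij_inv_eq_iff)

lemma locally_integrable_compose_isometry:
  fixes g :: "real^'n \<Rightarrow> real" and Q :: "real^'n \<Rightarrow> real^'n"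
  assumes Q: "orthogonal_transformation Q" and g: "locally_integrable g"
  shows "locally_integrable (\<lambda>x. g (Q x + z))"
  unfolding locally_integrable_def
proof (intro allI impI)
  fix K :: "(real^'n) set" assume K: "compact K"
  define K' where "K' = (\<lambda>x. Q x + z) ` K"
  have K': "compact K'"
    unfolding K'_def by (rule compact_continuous_image[OF continuous_on_isometry[OF Q] K])
  have "inj (\<lambda>x. Q x + z)"
    using orthogonal_transformation_inj[OF Q] by (simp add: inj_def)
  then have "Q x + z \<in> K' \<longleftrightarrow> x \<in> K" for x
    unfolding K'_def by (rule inj_image_mem_iff)
  then have ind: "indicator K' (Q x + z) = (indicator K x :: real)" for x
    by (simp add: indicator_def)
  have [measurable]: "g \<in> borel_measurable borel" by (rule locally_integrable_measurable[OF g])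
  have m: "(\<lambda>x. indicator K' x * g x) \<in> borel_measurable borel"
    using K' by (intro borel_measurable_times borel_measurable_indicator) (auto simp: borel_compact)
  have "integrable lborel (\<lambda>x. indicator K' x * g x)"
    using g K' unfolding locally_integrable_def set_integrable_def by simp
  then have "integrable lborel (\<lambda>x. indicator K' (Q x + z) * g (Q x + z))"
    using integrable_lborel_isometry[OF Q m, of z] by simp
  then show "set_integrable lborel K (\<lambda>x. g (Q x + z))"
    by (simp add: ind set_integrable_def)
qed

text \<open>The isometry is moved to the test function: the classical chain rule is applied there,
  and invariance of Lebesgue measure carries the integrals back and forth.\<close>

lemma has_weak_partial_compose_isometry:
  fixes v :: "real^'n \<Rightarrow> real" and Q :: "real^'n \<Rightarrow> real^'n"
  assumes Q: "orthogonal_transformation Q" and v: "locally_integrable v"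
    and wp: "\<And>j. has_weak_partial v j (g j)"
  shows "has_weak_partial (\<lambda>x. v (Q x + z)) i (\<lambda>x. \<Sum>j\<in>UNIV. Q (axis i 1) $ j * g j (Q x + z))"
  unfolding has_weak_partial_def
proof (intro conjI allI impI)
  have g: "locally_integrable (g j)" for j using wp by (simp add: has_weak_partial_def)
  then show "locally_integrable (\<lambda>x. \<Sum>j\<in>UNIV. Q (axis i 1) $ j * g j (Q x + z))"
    by (intro locally_integrable_sum locally_integrable_scale locally_integrable_compose_isometry[OF Q])
  obtain Q' where Q': "orthogonal_transformation Q'" "\<And>x. Q (Q' x) = x" "\<And>x. Q' (Q x) = x"
    using orthogonal_transformation_inverse_isometry[OF Q] by blast
  fix \<phi> :: "real^'n \<Rightarrow> real" assume \<phi>: "test_function \<phi>"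
  \<comment> \<open>This is \<open>\<phi>\<close> composed with the inverse of the isometry
    \<open>\<lambda>x. Q x + z\<close>.\<close>
  define \<psi> where "\<psi> x = \<phi> (Q' x + - Q' z)" for x
  have \<psi>: "test_function \<psi>"
    unfolding \<psi>_def[abs_def] by (rule test_function_compose_isometry[OF Q'(1) \<phi>])
  have \<phi>\<psi>: "\<phi> = (\<lambda>x. \<psi> (Q x + z))"
    using linear_add[OF orthogonal_transformation_linear[OF Q'(1)]] by (simp add: \<psi>_def Q'(3))
  note [measurable] = locally_integrable_measurable[OF v] locally_integrable_measurable[OF g]
    borel_measurable_continuous_onI[OF test_function_continuous(2)[OF \<psi>]]
    borel_measurable_continuous_onI[OF test_function_continuous(3)[OF \<psi>]]
  have pd: "partial_deriv i \<phi> x = (\<Sum>j\<in>UNIV. Q (axis i 1) $ j * partial_deriv j \<psi> (Q x + z))" for x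
    unfolding \<phi>\<psi> using orthogonal_transformation_linear[OF Q] test_function_continuous(1)[OF \<psi>]
    by (rule partial_deriv_compose_affine(2))
  have "(\<integral>x. v (Q x + z) * partial_deriv i \<phi> x \<partial>lborel)
      = (\<integral>x. (\<lambda>y. \<Sum>j\<in>UNIV. Q (axis i 1) $ j * (v y * partial_deriv j \<psi> y)) (Q x + z) \<partial>lborel)"
    by (simp add: pd sum_distrib_left mult.left_commute)
  also have "\<dots> = (\<integral>y. (\<Sum>j\<in>UNIV. Q (axis i 1) $ j * (v y * partial_deriv j \<psi> y)) \<partial>lborel)"
    by (rule integral_lborel_isometry[OF Q]) measurable
  also have "\<dots> = (\<Sum>j\<in>UNIV. Q (axis i 1) $ j * (\<integral>y. v y * partial_deriv j \<psi> y \<partial>lborel))"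
    using integrable_mult_test_function(2)[OF v \<psi>] by (simp add: Bochner_Integration.integral_sum)
  also have "\<dots> = (\<Sum>j\<in>UNIV. Q (axis i 1) $ j * - (\<integral>y. g j y * \<psi> y \<partial>lborel))"
    using wp \<psi> by (simp add: has_weak_partial_def)
  also have "\<dots> = - (\<integral>y. (\<Sum>j\<in>UNIV. Q (axis i 1) $ j * (g j y * \<psi> y)) \<partial>lborel)"
    using integrable_mult_test_function(1)[OF g \<psi>]
    by (simp add: Bochner_Integration.integral_sum sum_negf)
  also have "(\<integral>y. (\<Sum>j\<in>UNIV. Q (axis i 1) $ j * (g j y * \<psi> y)) \<partial>lborel)
      = (\<integral>x. (\<lambda>y. \<Sum>j\<in>UNIV. Q (axis i 1) $ j * (g j y * \<psi> y)) (Q x + z) \<partial>lborel)"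
    by (rule integral_lborel_isometry[OF Q, symmetric]) measurable
  also have "\<dots> = (\<integral>x. (\<Sum>j\<in>UNIV. Q (axis i 1) $ j * g j (Q x + z)) * \<phi> x \<partial>lborel)"
    by (simp add: \<phi>\<psi> sum_distrib_right mult.assoc)
  finally show "(\<integral>x. v (Q x + z) * partial_deriv i \<phi> x \<partial>lborel)
      = - (\<integral>x. (\<Sum>j\<in>UNIV. Q (axis i 1) $ j * g j (Q x + z)) * \<phi> x \<partial>lborel)" .
qed

text \<open>By orthogonality the chain rule coefficients \<open>Q (axis i 1) $ j\<close> form the
  matrix of the inverse \<open>Q'\<close>. The gradient of the composition is thus \<open>Q'\<close>
  applied to the gradient of \<open>v\<close>, and \<open>Q'\<close> preserves norms.\<close>

lemma norm_weak_grad_compose_isometry: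
  fixes v :: "real^'n \<Rightarrow> real" and Q :: "real^'n \<Rightarrow> real^'n"
  assumes Q: "orthogonal_transformation Q" and v: "locally_integrable v"
    and wp: "\<And>j. has_weak_partial v j (g j)"
  shows "AE x in lborel. norm (weak_grad (\<lambda>x. v (Q x + z)) x) = norm (weak_grad v (Q x + z))"
proof -
  obtain Q' where Q': "orthogonal_transformation Q'" "\<And>x. Q (Q' x) = x" "\<And>x. Q' (Q x) = x"
    using orthogonal_transformation_inverse_isometry[OF Q] by blast
  have comp: "(\<Sum>j\<in>UNIV. Q (axis i 1) $ j * y $ j) = Q' y $ i" for i y
  proof -
    have "(\<Sum>j\<in>UNIV. Q (axis i 1) $ j * y $ j) = Q (axis i 1) \<bullet> Q (Q' y)"
      by (simp add: inner_vec_def Q'(2))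
    also have "\<dots> = axis i 1 \<bullet> Q' y"
      using Q by (simp add: orthogonal_transformation_def)
    finally show ?thesis by (simp add: inner_axis' )
  qed
  have "has_weak_partial (\<lambda>x. v (Q x + z)) i (\<lambda>x. Q' (weak_grad v (Q x + z)) $ i)" for i
    using has_weak_partial_compose_isometry[OF Q v has_weak_partial_weak_partial[OF wp], of z i]
    by (simp add: comp[symmetric] weak_grad_def)
  from weak_grad_AE_eq[OF this] show ?thesis
    by eventually_elim (simp add: orthogonal_transformation_norm[OF Q'(1)])
qed

section \<open>Closure properties of \<open>Lp\<close> and \<open>D1p\<close>\<close>

lemma Lp_lincomb:
  assumes f: "f \<in> Lp p" and g: "g \<in> Lp p" and p: "p > 0"
  shows "(\<lambda>x. a * f x + b * g x) \<in> Lp p"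
proof -
  have [measurable]: "f \<in> borel_measurable borel" "g \<in> borel_measurable borel"
    and i: "integrable lborel (\<lambda>x. \<bar>f x\<bar> powr p)" "integrable lborel (\<lambda>x. \<bar>g x\<bar> powr p)"
    using f g by (simp_all add: Lp_def)
  define c where "c = \<bar>a\<bar> + \<bar>b\<bar>"
  \<comment> \<open>Estimating through the maximum avoids convexity, so the bound holds for every p
    > 0.\<close>
  have bd: "\<bar>a * s + b * t\<bar> powr p \<le> c powr p * (\<bar>s\<bar> powr p + \<bar>t\<bar> powr p)" for s t
  proof -
    have "\<bar>a * s + b * t\<bar> \<le> \<bar>a\<bar> * \<bar>s\<bar> + \<bar>b\<bar> * \<bar>t\<bar>"
      by (metis abs_mult abs_triangle_ineq)
    also have "\<dots> \<le> \<bar>a\<bar> * max \<bar>s\<bar> \<bar>t\<bar> + \<bar>b\<bar> * max \<bar>s\<bar> \<bar>t\<bar>"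
      by (intro add_mono mult_left_mono) auto
    also have "\<dots> = c * max \<bar>s\<bar> \<bar>t\<bar>" by (simp add: c_def algebra_simps)
    finally have "\<bar>a * s + b * t\<bar> powr p \<le> (c * max \<bar>s\<bar> \<bar>t\<bar>) powr p"
      using p by (intro powr_mono2) auto
    also have "\<dots> = c powr p * max \<bar>s\<bar> \<bar>t\<bar> powr p"
      by (simp add: powr_mult c_def)
    also have "\<dots> \<le> c powr p * (\<bar>s\<bar> powr p + \<bar>t\<bar> powr p)"
      by (intro mult_left_mono) (auto simp: max_def)
    finally show ?thesis .
  qed
  have "integrable lborel (\<lambda>x. \<bar>a * f x + b * g x\<bar> powr p)"
  proof (rule Bochner_Integration.integrable_bound)
    show "integrable lborel (\<lambda>x. c powr p * (\<bar>f x\<bar> powr p + \<bar>g x\<bar> powr p))"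
      using i by simp
    show "AE x in lborel. norm (\<bar>a * f x + b * g x\<bar> powr p) \<le> norm (c powr p * (\<bar>f x\<bar> powr p + \<bar>g x\<bar> powr p))"
      by (intro AE_I2) (use bd in \<open>simp add: abs_mult\<close>)
  qed simp
  then show ?thesis by (simp add: Lp_def)
qed

lemma Lp_sum:
  assumes "p > 0" "\<And>i. i \<in> I \<Longrightarrow> f i \<in> Lp p"
  shows "(\<lambda>x. \<Sum>i\<in>I. a i * f i x) \<in> Lp p"
  using assms(2)
proof (induction I rule: infinite_finite_induct)
  case (insert i I)
  then have "(\<lambda>x. a i * f i x + 1 * (\<Sum>i\<in>I. a i * f i x)) \<in> Lp p"
    by (intro Lp_lincomb assms(1)) auto
  with insert show ?case by simp
qed (simp_all add: Lp_def)

lemma Lp_compose_isometry: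
  fixes f :: "real^'n \<Rightarrow> real" and Q :: "real^'n \<Rightarrow> real^'n"
  assumes Q: "orthogonal_transformation Q" and f: "f \<in> Lp p"
  shows "(\<lambda>x. f (Q x + z)) \<in> Lp p"
proof -
  have [measurable]: "f \<in> borel_measurable borel" and i: "integrable lborel (\<lambda>x. \<bar>f x\<bar> powr p)"
    using f by (simp_all add: Lp_def)
  have [measurable]: "(\<lambda>x. Q x + z) \<in> borel_measurable borel"
    by (rule borel_measurable_continuous_onI[OF continuous_on_isometry[OF Q]])
  have "(\<lambda>x. \<bar>f x\<bar> powr p) \<in> borel_measurable borel" by measurable
  from integrable_lborel_isometry[OF Q this, of z] i show ?thesis
    by (simp add: Lp_def)
qed

lemma hoelder_continuous:
  fixes u :: "real^'n \<Rightarrow> real"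
  assumes "hoelder a u" "a > 0"
  shows "continuous_on UNIV u"
proof -
  obtain K where K: "\<And>x y. \<bar>u x - u y\<bar> \<le> K * norm (x - y) powr a"
    using assms(1) unfolding hoelder_def by blast
  have "(u \<longlongrightarrow> u x) (at x)" for x
  proof (rule Lim_transform)
    show "((\<lambda>_. u x) \<longlongrightarrow> u x) (at x)" by simp
    show "((\<lambda>y. u y - u x) \<longlongrightarrow> 0) (at x)"
    proof (rule Lim_null_comparison)
      show "\<forall>\<^sub>F y in at x. norm (u y - u x) \<le> K * norm (y - x) powr a"
        using K by simp
      have "((\<lambda>y. norm (y - x)) \<longlongrightarrow> norm (x - x)) (at x)" by (intro tendsto_intros)
      then have "((\<lambda>y. norm (y - x) powr a) \<longlongrightarrow> 0) (at x)"
        using assms(2) by (intro tendsto_zero_powrI[of _ _ _ a]) auto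
      then show "((\<lambda>y. K * norm (y - x) powr a) \<longlongrightarrow> 0) (at x)"
        by (rule tendsto_mult_right_zero)
    qed
  qed
  then show ?thesis by (simp add: continuous_on_def)
qed

lemma D1p_continuous:
  fixes u :: "real^'n \<Rightarrow> real"
  assumes "u \<in> D1p p" "real CARD('n) < p"
  shows "continuous_on UNIV u"
proof (rule hoelder_continuous)
  show "hoelder (1 - real CARD('n) / p) u" using assms(1) by (simp add: D1p_def)
  show "1 - real CARD('n) / p > 0" using assms(2) by (simp add: field_simps) 
qed

lemma D1p_weak_partials:
  assumes "u \<in> D1p p"
  obtains g where "\<And>i. g i \<in> Lp p" "\<And>i. has_weak_partial u i (g i)"
proof -
  have "\<forall>i. \<exists>g. g \<in> Lp p \<and> has_weak_partial u i g"
    using assms unfolding D1p_def by blast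
  from choice[OF this] show ?thesis using that by blast
qed

lemma D1p_lincomb:
  fixes u w :: "real^'n \<Rightarrow> real"
  assumes u: "u \<in> D1p p" and w: "w \<in> D1p p" and p: "p > 0"
  shows "(\<lambda>x. a * u x + b * w x) \<in> D1p p"
proof -
  have "\<exists>g\<in>Lp p. has_weak_partial (\<lambda>x. a * u x + b * w x) i g" for i
  proof -
    obtain g h where "g \<in> Lp p" "has_weak_partial u i g" "h \<in> Lp p" "has_weak_partial w i h"
      using u w unfolding D1p_def by blast
    with u w p show ?thesis
      by (intro bexI[of _ "\<lambda>x. a * g x + b * h x"] has_weak_partial_lincomb Lp_lincomb)
        (auto simp: D1p_def)
  qed
  moreover have "hoelder (1 - real CARD('n) / p) (\<lambda>x. a * u x + b * w x)"
  proof -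
    obtain K L where K: "\<And>x y. \<bar>u x - u y\<bar> \<le> K * norm (x - y) powr (1 - real CARD('n) / p)"
      and L: "\<And>x y. \<bar>w x - w y\<bar> \<le> L * norm (x - y) powr (1 - real CARD('n) / p)"
      using u w unfolding D1p_def hoelder_def by blast
    have "\<bar>(a * u x + b * w x) - (a * u y + b * w y)\<bar>
        \<le> (\<bar>a\<bar> * K + \<bar>b\<bar> * L) * norm (x - y) powr (1 - real CARD('n) / p)" for x y
    proof -
      have "\<bar>(a * u x + b * w x) - (a * u y + b * w y)\<bar> = \<bar>a * (u x - u y) + b * (w x - w y)\<bar>"
        by (simp add: algebra_simps)
      also have "\<dots> \<le> \<bar>a\<bar> * \<bar>u x - u y\<bar> + \<bar>b\<bar> * \<bar>w x - w y\<bar>"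
        by (metis abs_mult abs_triangle_ineq)
      also have "\<dots> \<le> \<bar>a\<bar> * (K * norm (x - y) powr (1 - real CARD('n) / p))
          + \<bar>b\<bar> * (L * norm (x - y) powr (1 - real CARD('n) / p))"
        by (intro add_mono mult_left_mono K L) auto
      finally show ?thesis by (simp add: algebra_simps)
    qed
    then show ?thesis unfolding hoelder_def by blast
  qed
  ultimately show ?thesis
    using u w by (auto simp: D1p_def intro!: locally_integrable_add locally_integrable_scale)
qed

lemma D1p_compose_isometry:
  fixes v :: "real^'n \<Rightarrow> real" and Q :: "real^'n \<Rightarrow> real^'n"
  assumes Q: "orthogonal_transformation Q" and v: "v \<in> D1p p" and p: "p > 0"
  shows "(\<lambda>x. v (Q x + z)) \<in> D1p p"
proof -
  obtain g where g: "\<And>i. g i \<in> Lp p" "\<And>i. has_weak_partial v i (g i)"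
    using D1p_weak_partials[OF v] by blast
  have li: "locally_integrable v" using v by (simp add: D1p_def)
  have "\<exists>h\<in>Lp p. has_weak_partial (\<lambda>x. v (Q x + z)) i h" for i
    using has_weak_partial_compose_isometry[OF Q li g(2), of z i]
      Lp_sum[OF p, of UNIV "\<lambda>j x. g j (Q x + z)" "\<lambda>j. Q (axis i 1) $ j"]
      Lp_compose_isometry[OF Q g(1)] by blast
  moreover have "hoelder (1 - real CARD('n) / p) (\<lambda>x. v (Q x + z))"
  proof -
    obtain K where K: "\<And>x y. \<bar>v x - v y\<bar> \<le> K * norm (x - y) powr (1 - real CARD('n) / p)"
      using v unfolding D1p_def hoelder_def by blast
    have "norm ((Q x + z) - (Q y + z)) = norm (x - y)" for x y
      using linear_diff[OF orthogonal_transformation_linear[OF Q], of x y]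
        orthogonal_transformation_norm[OF Q, of "x - y"] by simp
    then have "\<bar>v (Q x + z) - v (Q y + z)\<bar> \<le> K * norm (x - y) powr (1 - real CARD('n) / p)" for x y
      using K[of "Q x + z" "Q y + z"] by simp
    then show ?thesis unfolding hoelder_def by blast
  qed
  ultimately show ?thesis
    using locally_integrable_compose_isometry[OF Q li] by (auto simp: D1p_def)
qed

text \<open>Each component of the chosen gradient agrees almost everywhere with the witness in
  \<open>Lp\<close> from \<open>D1p\<close>, and the norm is at most the sum of the absolute values
  of the components.\<close>

lemma
  fixes u :: "real^'n \<Rightarrow> real"
  assumes u: "u \<in> D1p p" and p: "p > 0"
  shows weak_grad_measurable: "weak_grad u \<in> borel_measurable borel"
    and weak_grad_integrable: "integrable lborel (\<lambda>x. norm (weak_grad u x) powr p)"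
proof -
  obtain g where g: "\<And>i. g i \<in> Lp p" "\<And>i. has_weak_partial u i (g i)"
    using D1p_weak_partials[OF u] by blast
  have [measurable]: "g i \<in> borel_measurable borel" for i using g(1) by (simp add: Lp_def)
  have m [measurable]: "weak_partial u i \<in> borel_measurable borel" for i
    using has_weak_partial_weak_partial[OF g(2)] unfolding has_weak_partial_def
    by (auto intro: locally_integrable_measurable)
  have "(\<lambda>x. \<chi> i. weak_partial u i x) \<in> borel_measurable borel"
    using m by (subst borel_measurable_euclidean_space) (auto simp: Basis_vec_def inner_axis)
  then show [measurable]: "weak_grad u \<in> borel_measurable borel"
    by (simp add: weak_grad_def[abs_def])
  have L: "(\<lambda>x. \<bar>weak_partial u i x\<bar>) \<in> Lp p" for i
  proof -
    have "integrable lborel (\<lambda>x. \<bar>weak_partial u i x\<bar> powr p) = integrable lborel (\<lambda>x. \<bar>g i x\<bar> powr p)"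
    proof (rule integrable_cong_AE)
      show "AE x in lborel. \<bar>weak_partial u i x\<bar> powr p = \<bar>g i x\<bar> powr p"
        using weak_partial_AE_eq[OF g(2)[of i]] by eventually_elim simp
    qed simp_all
    then show ?thesis using g(1) m by (simp add: Lp_def)
  qed
  have i: "integrable lborel (\<lambda>x. \<bar>\<Sum>i\<in>UNIV. \<bar>weak_partial u i x\<bar>\<bar> powr p)"
    using Lp_sum[OF p, of UNIV "\<lambda>i x. \<bar>weak_partial u i x\<bar>" "\<lambda>_. 1"] L
    by (simp add: Lp_def)
  show "integrable lborel (\<lambda>x. norm (weak_grad u x) powr p)"
  proof (rule Bochner_Integration.integrable_bound[OF i])
    have "norm (weak_grad u x) \<le> (\<Sum>i\<in>UNIV. \<bar>weak_partial u i x\<bar>)" for x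
      using norm_le_l1_cart[of "weak_grad u x"] by (simp add: weak_grad_def)
    then show "AE x in lborel. norm (norm (weak_grad u x) powr p) \<le> norm (\<bar>\<Sum>i\<in>UNIV. \<bar>weak_partial u i x\<bar>\<bar> powr p)"
      using p by (intro AE_I2) (simp add: powr_mono2)
  qed simp
qed

section \<open>Strict convexity of powers of the norm\<close>

lemma powr_midpoint_le:
  fixes s t q :: real
  assumes "q \<ge> 1" "s \<ge> 0" "t \<ge> 0"
  shows "((s + t) / 2) powr q \<le> (s powr q + t powr q) / 2"
proof -
  \<comment> \<open>For s = 0 or t = 0 the claim is this scaling bound; convexity is applied at
    positive arguments.\<close>
  have half: "(r / 2) powr q \<le> r powr q / 2" if "r \<ge> 0" for r
  proof -
    have "(r / 2) powr q = r powr q * (1 / 2) powr q"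
      using that by (simp add: powr_divide powr_one_eq_one)
    also have "(1 / 2) powr q \<le> (1 / 2 :: real) powr 1"
      using assms(1) by (intro powr_mono') auto
    finally show ?thesis by (simp add: mult_left_mono)
  qed
  consider "s = 0" | "t = 0" | "s > 0" "t > 0" using assms by linarith
  then show ?thesis
  proof cases
    case 3
    with convex_onD[OF powr_convex[OF assms(1)], of "1/2" s t] show ?thesis
      by (simp add: field_simps)
  qed (use half assms in auto)
qed

text \<open>The parallelogram identity gives a strict inequality for squared norms. It survives the
  power \<open>p / 2\<close>, which is strictly increasing and, as its exponent is at least 1,
  convex.\<close>

lemma norm_powr_midpoint_less:
  fixes a b :: "'a::real_inner"
  assumes "p \<ge> 2" "a \<noteq> b"
  shows "norm ((1/2) *\<^sub>R a + (1/2) *\<^sub>R b) powr p < (norm a powr p + norm b powr p) / 2"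
proof -
  have sq: "norm x powr p = ((norm x)\<^sup>2) powr (p / 2)" for x :: 'a
  proof -
    have "(norm x)\<^sup>2 = norm x powr 2" by simp
    then show ?thesis by (simp only: powr_powr) simp
  qed
  have "(norm ((1/2) *\<^sub>R a + (1/2) *\<^sub>R b))\<^sup>2 = ((norm a)\<^sup>2 + (norm b)\<^sup>2) / 2 - (norm (a - b))\<^sup>2 / 4"
    by (simp add: power2_norm_eq_inner inner_simps inner_commute field_simps)
  also have "\<dots> < ((norm a)\<^sup>2 + (norm b)\<^sup>2) / 2"
  proof -
    have "(norm (a - b))\<^sup>2 > 0" using assms(2) by simp
    then show ?thesis by linarith
  qed
  finally have "((norm ((1/2) *\<^sub>R a + (1/2) *\<^sub>R b))\<^sup>2) powr (p / 2) < (((norm a)\<^sup>2 + (norm b)\<^sup>2) / 2) powr (p / 2)"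
    using assms(1) by (intro powr_less_mono2) auto
  also have "\<dots> \<le> (((norm a)\<^sup>2) powr (p / 2) + ((norm b)\<^sup>2) powr (p / 2)) / 2"
    using assms(1) by (intro powr_midpoint_le) auto
  finally show ?thesis by (simp only: sq)
qed

section \<open>Test functions and the Morrey constant\<close>

text \<open>Difference quotients along the axis have integral 0 by translation invariance, and
  dominated convergence passes this on to the derivative.\<close>

lemma integral_partial_deriv_eq_0:
  fixes F :: "real^'n \<Rightarrow> real"
  assumes d: "\<And>x. F differentiable at x" and c: "continuous_on UNIV (partial_deriv i F)"
    and K: "compact K" "\<And>x. x \<notin> K \<Longrightarrow> F x = 0" "\<And>x. x \<notin> K \<Longrightarrow> partial_deriv i F x = 0"
  shows "(\<integral>x. partial_deriv i F x \<partial>lborel) = 0"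
proof -
  define e :: "real^'n" where "e = axis i 1"
  define h where "h n = inverse (real (Suc n))" for n
  have h: "0 < h n" "h n \<le> 1" for n by (simp_all add: h_def inverse_le_1_iff)
  have ne: "norm e = 1" by (simp add: e_def norm_axis_1)
  have cF: "continuous_on UNIV F"
    using d by (auto simp: continuous_on_eq_continuous_at intro: differentiable_imp_continuous_within)
  then have [measurable]: "F \<in> borel_measurable borel" by (rule borel_measurable_continuous_onI)
  have iF: "integrable lborel F"
    using integrable_mult_compact_support[OF continuous_locally_integrable[of "\<lambda>_. 1"] cF K(1,2)] by simp
  have line: "((\<lambda>t. F (x + t *\<^sub>R e)) has_real_derivative partial_deriv i F (x + t *\<^sub>R e)) (at t)" for x t
  proof -
    have "((\<lambda>t. x + t *\<^sub>R e) has_derivative (\<lambda>t. t *\<^sub>R e)) (at t)"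
      by (auto intro!: derivative_eq_intros)
    from has_derivative_compose[OF this has_derivative_partial_deriv[OF d]]
    have "((\<lambda>t. F (x + t *\<^sub>R e)) has_derivative
      (\<lambda>s. \<Sum>j\<in>UNIV. (s *\<^sub>R e) $ j * partial_deriv j F (x + t *\<^sub>R e))) (at t)" .
    moreover have "(\<Sum>j\<in>UNIV. (s *\<^sub>R e) $ j * partial_deriv j F (x + t *\<^sub>R e))
        = partial_deriv i F (x + t *\<^sub>R e) * s" for s
    proof -
      have "(\<Sum>j\<in>UNIV. (s *\<^sub>R e) $ j * partial_deriv j F (x + t *\<^sub>R e))
          = (\<Sum>j\<in>UNIV. if j = i then s * partial_deriv j F (x + t *\<^sub>R e) else 0)"
        by (intro sum.cong) (auto simp: e_def axis_def)
      then show ?thesis by (simp add: mult.commute)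
    qed
    ultimately show ?thesis by (simp add: has_field_derivative_def)
  qed
  have "bounded (partial_deriv i F ` K)"
    by (intro compact_imp_bounded compact_continuous_image K continuous_on_subset[OF c]) auto
  then obtain B where B': "\<And>x. x \<in> K \<Longrightarrow> \<bar>partial_deriv i F x\<bar> \<le> B"
    unfolding bounded_iff by auto
  have B: "\<bar>partial_deriv i F x\<bar> \<le> \<bar>B\<bar>" for x
    using K(3)[of x] B'[of x] by (cases "x \<in> K") auto
  obtain R where R: "\<And>x. x \<in> K \<Longrightarrow> norm x \<le> R"
    using compact_imp_bounded[OF K(1)] unfolding bounded_iff by blast
  define s where "s n x = (F (x + h n *\<^sub>R e) - F x) / h n" for n x
  have zero: "(\<integral>x. s n x \<partial>lborel) = 0" for n
  proof -
    have "integrable lborel (\<lambda>x. F (x + h n *\<^sub>R e))"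
      using integrable_lborel_isometry[of "\<lambda>x. x" F "h n *\<^sub>R e"] iF by simp
    then have "(\<integral>x. s n x \<partial>lborel) = ((\<integral>x. F (x + h n *\<^sub>R e) \<partial>lborel) - (\<integral>x. F x \<partial>lborel)) / h n"
      using iF by (simp add: s_def)
    then show ?thesis using integral_lborel_translate[of F "h n *\<^sub>R e"] by simp
  qed
  have lim: "(\<lambda>n. s n x) \<longlonglongrightarrow> partial_deriv i F x" for x
  proof -
    have "((\<lambda>t. (F (x + t *\<^sub>R e) - F x) / t) \<longlongrightarrow> partial_deriv i F x) (at 0)"
      using line[of x 0] by (simp add: has_field_derivative_iff)
    moreover have "filterlim h (at 0) sequentially"
      unfolding filterlim_at h_def[abs_def] using LIMSEQ_inverse_real_of_nat by auto
    ultimately show ?thesis unfolding s_def by (rule filterlim_compose)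
  qed
  \<comment> \<open>The mean value theorem bounds the quotients uniformly, and since
    \<open>h n \<le> 1\<close> all of them vanish off the ball of radius
    \<open>R + 1\<close>.\<close>
  have bd: "\<bar>s n x\<bar> \<le> \<bar>B\<bar> * indicator (cball 0 (R + 1)) x" for n x
  proof (cases "x \<in> cball 0 (R + 1)")
    case True
    obtain t where "F (x + h n *\<^sub>R e) - F (x + 0 *\<^sub>R e) = (h n - 0) * partial_deriv i F (x + t *\<^sub>R e)"
      using MVT2[OF h(1) line[of x]] by blast
    then have "s n x = partial_deriv i F (x + t *\<^sub>R e)"
      using h(1)[of n] by (simp add: s_def)
    then show ?thesis using B True by simp
  next
    case False
    then have "norm x > R + 1" by simp
    moreover have "norm x \<le> norm (x + h n *\<^sub>R e) + h n"
      using norm_triangle_ineq4[of "x + h n *\<^sub>R e" "h n *\<^sub>R e"] h(1)[of n] ne by simp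
    ultimately have "x \<notin> K" "x + h n *\<^sub>R e \<notin> K"
      using R[of x] R[of "x + h n *\<^sub>R e"] h(2)[of n] by auto
    then show ?thesis using K(2) by (simp add: s_def)
  qed
  have "(\<lambda>n. \<integral>x. s n x \<partial>lborel) \<longlonglongrightarrow> (\<integral>x. partial_deriv i F x \<partial>lborel)"
  proof (rule integral_dominated_convergence)
    show "integrable lborel (\<lambda>x::real^'n. \<bar>B\<bar> * indicator (cball 0 (R + 1)) x)"
      using emeasure_lborel_cball_finite[of "0::real^'n" "R + 1"] by (intro integrable_mult_right) simp
    show "s n \<in> borel_measurable lborel" for n
      unfolding s_def by simp
    show "partial_deriv i F \<in> borel_measurable lborel"
      using borel_measurable_continuous_onI[OF c] by simp
  qed (use lim bd in auto)
  then have "(\<lambda>n. 0) \<longlonglongrightarrow> (\<integral>x. partial_deriv i F x \<partial>lborel)"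
    by (simp only: zero)
  then show ?thesis by (rule LIMSEQ_unique[OF _ tendsto_const])
qed

text \<open>Integration by parts: the derivative of the compactly supported product
  \<open>u x * \<phi> x\<close> has integral 0.\<close>

lemma has_weak_partial_test_function:
  fixes u :: "real^'n \<Rightarrow> real"
  assumes u: "test_function u"
  shows "has_weak_partial u i (partial_deriv i u)"
  unfolding has_weak_partial_def
proof (intro conjI allI impI)
  have li: "locally_integrable u" "locally_integrable (partial_deriv i u)"
    using test_function_continuous[OF u] by (auto intro: continuous_locally_integrable)
  then show "locally_integrable (partial_deriv i u)" by simp
  fix \<phi> :: "real^'n \<Rightarrow> real" assume \<phi>: "test_function \<phi>"
  note cu = test_function_continuous[OF u] and c\<phi> = test_function_continuous[OF \<phi>]
  have d: "((\<lambda>x. u x * \<phi> x) has_derivative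
      (\<lambda>h. u x * frechet_derivative \<phi> (at x) h + frechet_derivative u (at x) h * \<phi> x)) (at x)" for x
    using cu(1) c\<phi>(1) frechet_derivative_works by (intro has_derivative_mult) blast+
  have pd: "partial_deriv i (\<lambda>x. u x * \<phi> x) = (\<lambda>x. u x * partial_deriv i \<phi> x + partial_deriv i u x * \<phi> x)"
    using partial_deriv_eq[OF d] by (simp add: partial_deriv_def fun_eq_iff)
  obtain K where K: "compact K" "\<And>x. x \<notin> K \<Longrightarrow> \<phi> x = 0" "\<And>i x. x \<notin> K \<Longrightarrow> partial_deriv i \<phi> x = 0"
    using test_function_support[OF \<phi>] by blast
  have "(\<integral>x. partial_deriv i (\<lambda>x. u x * \<phi> x) x \<partial>lborel) = 0"
  proof (rule integral_partial_deriv_eq_0[OF _ _ K(1)])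
    show "(\<lambda>x. u x * \<phi> x) differentiable at x" for x
      using d unfolding differentiable_def by blast
    show "continuous_on UNIV (partial_deriv i (\<lambda>x. u x * \<phi> x))"
      unfolding pd by (intro continuous_on_add continuous_on_mult cu c\<phi>)
  qed (use K pd in auto)
  then show "(\<integral>x. u x * partial_deriv i \<phi> x \<partial>lborel) = - (\<integral>x. partial_deriv i u x * \<phi> x \<partial>lborel)"
    using integrable_mult_test_function(2)[OF li(1) \<phi>, of i] integrable_mult_test_function(1)[OF li(2) \<phi>]
    by (simp add: pd)
qed

lemma test_function_in_D1p:
  fixes u :: "real^'n \<Rightarrow> real"
  assumes u: "test_function u" and p: "real CARD('n) < p"
  shows "u \<in> D1p p"
proof -
  have p0: "p > 0" using p by (meson of_nat_0_le_iff le_less_trans)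
  note c = test_function_continuous[OF u]
  obtain K where K: "compact K" "\<And>x. x \<notin> K \<Longrightarrow> u x = 0" "\<And>i x. x \<notin> K \<Longrightarrow> partial_deriv i u x = 0"
    using test_function_support[OF u] by blast
  have bdd: "\<exists>B\<ge>0. \<forall>x. \<bar>f x\<bar> \<le> B" if f: "continuous_on UNIV f" "\<And>x. x \<notin> K \<Longrightarrow> f x = 0" for f :: "real^'n \<Rightarrow> real"
  proof -
    have "bounded (f ` K)"
      by (intro compact_imp_bounded compact_continuous_image K continuous_on_subset[OF f(1)]) auto
    then obtain B where B: "\<And>x. x \<in> K \<Longrightarrow> \<bar>f x\<bar> \<le> B" unfolding bounded_iff by auto
    have "\<bar>f x\<bar> \<le> \<bar>B\<bar>" for x
      using B[of x] f(2)[of x] by (cases "x \<in> K") auto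
    then show ?thesis by (intro exI[of _ "\<bar>B\<bar>"]) auto
  qed
  have "partial_deriv i u \<in> Lp p" for i
  proof -
    have "continuous_on UNIV (\<lambda>x. \<bar>partial_deriv i u x\<bar> powr p)"
      using p0 by (intro continuous_on_powr' continuous_intros c) auto
    from integrable_mult_compact_support[OF continuous_locally_integrable[of "\<lambda>_. 1"] this K(1)] K(3)
    show ?thesis
      using borel_measurable_continuous_onI[OF c(3)] by (simp add: Lp_def)
  qed
  then have 1: "\<forall>i. \<exists>g\<in>Lp p. has_weak_partial u i g"
    using has_weak_partial_test_function[OF u] by blast
  obtain M where M: "M \<ge> 0" "\<And>x. \<bar>u x\<bar> \<le> M" using bdd[OF c(2) K(2)] by blast
  have "\<forall>i. \<exists>B\<ge>0. \<forall>x. \<bar>partial_deriv i u x\<bar> \<le> B" using bdd[OF c(3) K(3)] by blast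
  then obtain B where B: "\<And>i. B i \<ge> 0" "\<And>i x. \<bar>partial_deriv i u x\<bar> \<le> B i" by metis
  define L where "L = (\<Sum>i\<in>UNIV. B i)"
  have L0: "L \<ge> 0" using B(1) by (simp add: L_def sum_nonneg)
  have lip: "\<bar>u x - u y\<bar> \<le> L * norm (x - y)" for x y
  proof -
    have "norm (u x - u y) \<le> L * norm (x - y)"
    proof (rule differentiable_bound[OF convex_UNIV])
      show "(u has_derivative (\<lambda>h. \<Sum>i\<in>UNIV. h $ i * partial_deriv i u x)) (at x within UNIV)" for x
        using has_derivative_partial_deriv[OF c(1)] by simp
      show "onorm (\<lambda>h. \<Sum>i\<in>UNIV. h $ i * partial_deriv i u x) \<le> L" for x
      proof (rule onorm_le)
        fix h :: "real^'n"
        have "norm (\<Sum>i\<in>UNIV. h $ i * partial_deriv i u x) \<le> (\<Sum>i\<in>UNIV. norm h * B i)"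
        proof (rule sum_norm_le)
          fix i
          show "norm (h $ i * partial_deriv i u x) \<le> norm h * B i"
            using B component_le_norm_cart[of h i] by (simp add: abs_mult mult_mono)
        qed
        then show "norm (\<Sum>i\<in>UNIV. h $ i * partial_deriv i u x) \<le> L * norm h"
          by (simp add: L_def sum_distrib_right sum_distrib_left mult.commute)
      qed
    qed auto
    then show ?thesis by simp
  qed
  define a where "a = 1 - real CARD('n) / p"
  have a: "0 \<le> a" "a \<le> 1" using p p0 by (simp_all add: a_def field_simps)
  \<comment> \<open>For distances up to 1 the Lipschitz bound implies the Hoelder bound with
    constant \<open>L\<close>; for larger ones \<open>\<bar>u x - u y\<bar> \<le> 2 * M\<close> is
    enough. The constant adds the two.\<close>
  have "\<bar>u x - u y\<bar> \<le> (L + 2 * M) * norm (x - y) powr a" for x y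
  proof -
    let ?d = "norm (x - y)"
    consider "x = y" | "0 < ?d" "?d \<le> 1" | "?d \<ge> 1" using zero_less_norm_iff[of "x - y"] by fastforce
    then show ?thesis
    proof cases
      case 2
      have "?d powr 1 \<le> ?d powr a" using 2 a by (intro powr_mono') auto
      then have "L * ?d \<le> L * ?d powr a" using L0 2 by (simp add: mult_left_mono)
      then have "\<bar>u x - u y\<bar> \<le> L * ?d powr a" using lip[of x y] by linarith
      also have "\<dots> \<le> (L + 2 * M) * ?d powr a" using M(1) by (intro mult_right_mono) auto
      finally show ?thesis .
    next
      case 3
      have "\<bar>u x - u y\<bar> \<le> (L + 2 * M) * 1" using abs_triangle_ineq4[of "u x" "u y"] M(2)[of x] M(2)[of y] L0 by simp
      also have "\<dots> \<le> (L + 2 * M) * ?d powr a"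
        using 3 a M(1) L0 by (intro mult_left_mono ge_one_powr_ge_zero) auto
      finally show ?thesis .
    qed simp
  qed
  then have "hoelder (1 - real CARD('n) / p) u" unfolding hoelder_def a_def by blast
  with 1 show ?thesis
    using c(2) by (simp add: D1p_def continuous_locally_integrable)
qed

section \<open>The Morrey inequality and positivity of its constant\<close>

lemma morrey_quotient_le_seminorm:
  fixes u :: "real^'n \<Rightarrow> real"
  shows "ennreal (morrey_quotient p \<rho> u) \<le> morrey_seminorm p \<rho> u"
proof -
  have "(\<lambda>y::real^'n. y) \<in> similarities"
    unfolding similarities_def
    by (intro CollectI exI[of _ 1] exI[of _ "\<lambda>y. y"] exI[of _ 0]) simp
  then have "ennreal (morrey_quotient p (push_forward (\<lambda>y. y) \<rho>) u) \<le> morrey_seminorm p \<rho> u"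
    unfolding morrey_seminorm_def by (rule SUP_upper)
  then show ?thesis by (simp add: push_forward_def)
qed

text \<open>For a positive gradient norm, dividing by it gives a lower bound of all competing
  constants, hence of their infimum. For gradient norm 0 a single competing constant suffices; it
  exists because the infimum of the empty set would be \<open>\<infinity>\<close>.\<close>

lemma morrey_inequality:
  fixes u :: "real^'n \<Rightarrow> real"
  assumes u: "u \<in> D1p p" and fin: "morrey_const p \<rho> \<noteq> \<infinity>"
  shows "morrey_seminorm p \<rho> u \<le> morrey_const p \<rho> * ennreal (grad_norm p u)"
proof -
  define A where "A = {C. \<forall>u \<in> D1p p. morrey_seminorm p \<rho> u \<le> C * ennreal (grad_norm p u)}"
  have c: "morrey_const p \<rho> = Inf A" by (simp add: morrey_const_def A_def)
  have A: "morrey_seminorm p \<rho> u \<le> C * ennreal (grad_norm p u)" if "C \<in> A" for C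
    using that u by (simp add: A_def)
  have "A \<noteq> {}" using fin c by auto
  show ?thesis
  proof (cases "grad_norm p u = 0")
    case True
    with A \<open>A \<noteq> {}\<close> show ?thesis by auto
  next
    case False
    then have g: "ennreal (grad_norm p u) \<noteq> 0" by (simp add: grad_norm_def ennreal_eq_0_iff)
    have "morrey_seminorm p \<rho> u / ennreal (grad_norm p u) \<le> Inf A"
      using A g by (intro Inf_greatest) (simp add: divide_le_posI_ennreal mult.commute zero_less_iff_neq_zero)
    then have "morrey_seminorm p \<rho> u / ennreal (grad_norm p u) * ennreal (grad_norm p u)
        \<le> Inf A * ennreal (grad_norm p u)"
      by (rule mult_right_mono) simp
    then show ?thesis
      using g by (simp add: c ennreal_divide_times ennreal_divide_self)
  qed
qed

text \<open>With constant 0 every product bump would have integral 0 against \<open>\<rho>\<close>.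
  The finite measures \<open>pos_part \<rho>\<close> and \<open>neg_part \<rho>\<close> would then
  coincide, and the first moment would vanish.\<close>

lemma morrey_const_pos:
  fixes \<rho> :: "(real^'n) set \<Rightarrow> real"
  assumes \<rho>: "admissible \<rho>" and p: "real CARD('n) < p"
  shows "morrey_const p \<rho> \<noteq> 0"
proof
  assume 0: "morrey_const p \<rho> = 0"
  have s: "signed_borel_measure \<rho>" and m: "signed_integral \<rho> (\<lambda>y. y) \<noteq> 0"
    using \<rho> by (simp_all add: admissible_def)
  interpret P: finite_measure "pos_part \<rho>" by (rule finite_measure_pos_part[OF s])
  interpret N: finite_measure "neg_part \<rho>" by (rule finite_measure_neg_part[OF s])
  have "pos_part \<rho> = neg_part \<rho>"
  proof (rule measure_eqI_product_bump)
    fix \<phi> :: "real^'n \<Rightarrow> real" assume "product_bump \<phi>"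
    then have "\<phi> \<in> D1p p" using p by (intro test_function_in_D1p test_function_product_bump)
    from morrey_inequality[OF this, of \<rho>] morrey_quotient_le_seminorm[of p \<rho> \<phi>]
    have "morrey_quotient p \<rho> \<phi> \<le> 0" using 0 by (simp add: ennreal_eq_0_iff)
    then have "\<bar>signed_integral \<rho> \<phi>\<bar> \<le> 0"
      using m unfolding morrey_quotient_def by (auto simp: divide_le_0_iff)
    then show "(\<integral>x. \<phi> x \<partial>pos_part \<rho>) = (\<integral>x. \<phi> x \<partial>neg_part \<rho>)"
      by (simp add: signed_integral_def)
  qed (simp_all add: P.emeasure_finite N.emeasure_finite less_top[symmetric])
  then have "signed_integral \<rho> (\<lambda>y. y) = 0" by (simp add: signed_integral_def)
  with m show False by simp
qed

section \<open>Extremals\<close>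

lemma
  fixes \<rho> :: "(real^'n) set \<Rightarrow> real" and f :: "real^'n \<Rightarrow> 'b::euclidean_space"
  assumes \<rho>: "admissible \<rho>" and f: "continuous_on UNIV f"
  shows admissible_integrable_pos_part: "integrable (pos_part \<rho>) f"
    and admissible_integrable_neg_part: "integrable (neg_part \<rho>) f"
  using \<rho> f by (auto simp: admissible_def intro: integrable_pos_part integrable_neg_part)

lemma signed_integral_add:
  fixes \<rho> :: "(real^'n) set \<Rightarrow> real" and f g :: "real^'n \<Rightarrow> 'b::euclidean_space"
  assumes \<rho>: "admissible \<rho>" and f: "continuous_on UNIV f" and g: "continuous_on UNIV g"
  shows "signed_integral \<rho> (\<lambda>x. f x + g x) = signed_integral \<rho> f + signed_integral \<rho> g"
  using admissible_integrable_pos_part[OF \<rho> f] admissible_integrable_neg_part[OF \<rho> f]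
    admissible_integrable_pos_part[OF \<rho> g] admissible_integrable_neg_part[OF \<rho> g]
  by (simp add: signed_integral_def)

lemma signed_integral_bounded_linear:
  fixes \<rho> :: "(real^'n) set \<Rightarrow> real" and f :: "real^'n \<Rightarrow> 'b::euclidean_space"
    and L :: "'b \<Rightarrow> 'c::euclidean_space"
  assumes \<rho>: "admissible \<rho>" and L: "bounded_linear L" and f: "continuous_on UNIV f"
  shows "signed_integral \<rho> (\<lambda>x. L (f x)) = L (signed_integral \<rho> f)"
  using integral_bounded_linear[OF L admissible_integrable_pos_part[OF \<rho> f]]
    integral_bounded_linear[OF L admissible_integrable_neg_part[OF \<rho> f]]
  by (simp add: signed_integral_def linear_diff bounded_linear.linear[OF L])

text \<open>Comparing first moments shows that the scaling factor is 1.\<close>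

lemma similarity_preserving_admissible:
  fixes \<rho> :: "(real^'n) set \<Rightarrow> real"
  assumes \<rho>: "admissible \<rho>" and T: "T \<in> similarities"
    and inv: "\<And>A. A \<in> sets borel \<Longrightarrow> push_forward T \<rho> A = \<rho> A"
  obtains Q z T' where "orthogonal_transformation Q" "T = (\<lambda>y. Q y + z)" "homeomorphism UNIV UNIV T T'"
proof -
  obtain l Q z where l: "l > 0" and Q: "orthogonal_transformation Q" and Teq: "T = (\<lambda>y. l *\<^sub>R Q y + z)"
    using T unfolding similarities_def by blast
  obtain Q' where Q': "orthogonal_transformation Q'" "\<And>x. Q (Q' x) = x" "\<And>x. Q' (Q x) = x"
    using orthogonal_transformation_inverse_isometry[OF Q] by blast
  note bl = orthogonal_transformation_bounded_linear[OF Q] orthogonal_transformation_bounded_linear[OF Q'(1)]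
  note lin = bl[THEN bounded_linear.linear]
  have hom: "homeomorphism UNIV UNIV T (\<lambda>x. Q' ((1 / l) *\<^sub>R (x - z)))"
  proof (rule homeomorphismI)
    show "continuous_on UNIV T"
      unfolding Teq by (intro continuous_intros linear_continuous_on bl)
    show "continuous_on UNIV (\<lambda>x. Q' ((1 / l) *\<^sub>R (x - z)))"
      by (intro continuous_on_compose2[OF linear_continuous_on[OF bl(2), of UNIV]] continuous_intros) auto
  qed (use l in \<open>simp_all add: Teq Q'\<close>)
  have \<rho>': "signed_borel_measure \<rho>" "\<rho> UNIV = 0" using \<rho> by (simp_all add: admissible_def)
  define m where "m = signed_integral \<rho> (\<lambda>y. y)"
  have m: "m \<noteq> 0" using \<rho> by (simp add: admissible_def m_def)
  have "m = signed_integral \<rho> (\<lambda>y. T y)"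
    unfolding m_def using signed_integral_invariant[OF \<rho>'(1) hom, of "\<lambda>y. y"] inv
    by (simp add: push_forward_def)
  also have "\<dots> = signed_integral \<rho> (\<lambda>y. l *\<^sub>R Q y) + signed_integral \<rho> (\<lambda>y. z)"
    unfolding Teq by (intro signed_integral_add[OF \<rho>] continuous_intros linear_continuous_on bl)
  \<comment> \<open>The translation drops out because constants have integral 0 against a signed
    measure of total mass 0.\<close>
  also have "\<dots> = l *\<^sub>R Q m"
    using signed_integral_bounded_linear[OF \<rho> bounded_linear_scaleR_right[THEN bounded_linear_compose, OF bl(1), of l], of "\<lambda>y. y"]
    by (simp add: signed_integral_const[OF \<rho>'] m_def)
  finally have "norm m = norm (l *\<^sub>R Q m)" by simp
  then have "norm m = l * norm m" using l by (simp add: orthogonal_transformation_norm[OF Q])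
  then have "l = 1" using m by simp
  with Q Teq hom show ?thesis by (intro that[of Q z]) simp_all
qed

section \<open>Gradient integrals and the equality case\<close>

lemma integral_norm_weak_grad_compose_isometry:
  fixes v :: "real^'n \<Rightarrow> real" and Q :: "real^'n \<Rightarrow> real^'n"
  assumes Q: "orthogonal_transformation Q" and v: "v \<in> D1p p" and p: "p > 0"
  shows "(\<integral>x. norm (weak_grad (\<lambda>x. v (Q x + z)) x) powr p \<partial>lborel)
    = (\<integral>x. norm (weak_grad v x) powr p \<partial>lborel)"
proof -
  obtain g where "\<And>i. g i \<in> Lp p" and g: "\<And>i. has_weak_partial v i (g i)"
    using D1p_weak_partials[OF v] by blast
  have li: "locally_integrable v" using v by (simp add: D1p_def)
  note [measurable] = weak_grad_measurable[OF v p] weak_grad_measurable[OF D1p_compose_isometry[OF Q v p, of z] p]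
  have [measurable]: "(\<lambda>x. Q x + z) \<in> borel_measurable borel"
    by (rule borel_measurable_continuous_onI[OF continuous_on_isometry[OF Q]])
  have "(\<integral>x. norm (weak_grad (\<lambda>x. v (Q x + z)) x) powr p \<partial>lborel)
      = (\<integral>x. (\<lambda>y. norm (weak_grad v y) powr p) (Q x + z) \<partial>lborel)"
  proof (rule integral_cong_AE)
    show "AE x in lborel. norm (weak_grad (\<lambda>x. v (Q x + z)) x) powr p = norm (weak_grad v (Q x + z)) powr p"
      using norm_weak_grad_compose_isometry[OF Q li g, of z] by eventually_elim simp
  qed measurable
  also have "\<dots> = (\<integral>x. norm (weak_grad v x) powr p \<partial>lborel)"
    by (rule integral_lborel_isometry[OF Q]) measurable
  finally show ?thesis .
qed

lemma weak_grad_eq_imp_diff_const: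
  fixes v w :: "real^'n \<Rightarrow> real"
  assumes v: "v \<in> D1p p" and w: "w \<in> D1p p" and p: "real CARD('n) < p"
    and eq: "AE x in lborel. weak_grad v x = weak_grad w x"
  shows "v x - w x = v 0 - w 0"
proof -
  obtain g where "\<And>i. g i \<in> Lp p" and g: "\<And>i. has_weak_partial v i (g i)"
    using D1p_weak_partials[OF v] by blast
  obtain h where "\<And>i. h i \<in> Lp p" and h: "\<And>i. has_weak_partial w i (h i)"
    using D1p_weak_partials[OF w] by blast
  have li: "locally_integrable v" "locally_integrable w" using v w by (simp_all add: D1p_def)
  have wp: "has_weak_partial (\<lambda>x. 1 * v x + (-1) * w x) i (\<lambda>x. 1 * weak_partial v i x + (-1) * weak_partial w i x)" for i
    by (intro has_weak_partial_lincomb li has_weak_partial_weak_partial[OF g] has_weak_partial_weak_partial[OF h])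
  have "1 * v x + (-1) * w x = 1 * v 0 + (-1) * w 0"
  proof (rule weak_partials_zero_imp_const[OF _ wp])
    show "continuous_on UNIV (\<lambda>x. 1 * v x + (-1) * w x)"
      by (intro continuous_intros D1p_continuous[OF v p] D1p_continuous[OF w p])
    show "AE x in lborel. 1 * weak_partial v i x + (-1) * weak_partial w i x = 0" for i
      using eq by eventually_elim (simp add: weak_grad_def vec_eq_iff)
  qed
  then show ?thesis by simp
qed

lemma weak_grad_zero_imp_const:
  fixes v :: "real^'n \<Rightarrow> real"
  assumes v: "v \<in> D1p p" and p: "real CARD('n) < p" and eq: "AE x in lborel. weak_grad v x = 0"
  shows "v x = v 0"
proof (rule weak_partials_zero_imp_const[OF D1p_continuous[OF v p]])
  obtain g where "\<And>i. g i \<in> Lp p" and g: "\<And>i. has_weak_partial v i (g i)"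
    using D1p_weak_partials[OF v] by blast
  show "has_weak_partial v i (weak_partial v i)" for i by (rule has_weak_partial_weak_partial[OF g])
  show "AE x in lborel. weak_partial v i x = 0" for i
    using eq by eventually_elim (simp add: weak_grad_def vec_eq_iff)
qed

text \<open>The convexity defect of the \<open>p\<close>-th power of the norm at the two gradients is nonnegative, has
  integral at most 0, and vanishes only where the gradients agree.\<close>

lemma weak_grad_eq_of_midpoint:
  fixes v w :: "real^'n \<Rightarrow> real"
  assumes v: "v \<in> D1p p" and w: "w \<in> D1p p" and p: "p \<ge> 2"
    and vw: "(\<integral>x. norm (weak_grad w x) powr p \<partial>lborel) = (\<integral>x. norm (weak_grad v x) powr p \<partial>lborel)"
    and mid: "(\<integral>x. norm (weak_grad v x) powr p \<partial>lborel)
      \<le> (\<integral>x. norm (weak_grad (\<lambda>x. 1/2 * v x + 1/2 * w x) x) powr p \<partial>lborel)"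
  shows "AE x in lborel. weak_grad v x = weak_grad w x"
proof -
  define u where "u x = 1/2 * v x + 1/2 * w x" for x
  have p0: "p > 0" using p by simp
  have u: "u \<in> D1p p" unfolding u_def[abs_def] by (rule D1p_lincomb[OF v w p0])
  obtain g where "\<And>i. g i \<in> Lp p" and g: "\<And>i. has_weak_partial v i (g i)"
    using D1p_weak_partials[OF v] by blast
  obtain h where "\<And>i. h i \<in> Lp p" and h: "\<And>i. has_weak_partial w i (h i)"
    using D1p_weak_partials[OF w] by blast
  have li: "locally_integrable v" "locally_integrable w" using v w by (simp_all add: D1p_def)
  have "has_weak_partial u i (\<lambda>x. ((1/2) *\<^sub>R weak_grad v x + (1/2) *\<^sub>R weak_grad w x) $ i)" for i
    using has_weak_partial_lincomb[OF li(1) has_weak_partial_weak_partial[OF g] li(2) has_weak_partial_weak_partial[OF h],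
        of "1/2" "1/2" i]
    by (simp add: u_def[abs_def] weak_grad_def)
  from weak_grad_AE_eq[OF this]
  have Du: "AE x in lborel. weak_grad u x = (1/2) *\<^sub>R weak_grad v x + (1/2) *\<^sub>R weak_grad w x" .
  define f where "f x = (norm (weak_grad v x) powr p + norm (weak_grad w x) powr p) / 2 - norm (weak_grad u x) powr p" for x
  note i = weak_grad_integrable[OF v p0] weak_grad_integrable[OF w p0] weak_grad_integrable[OF u p0]
  have fi: "integrable lborel f" unfolding f_def using i by simp
  have f0: "AE x in lborel. 0 \<le> f x"
    using Du
  proof eventually_elim
    case (elim x)
    show ?case
    proof (cases "weak_grad v x = weak_grad w x")
      case True
      then have "weak_grad u x = weak_grad w x" using elim by (simp flip: scaleR_left_distrib)
      with True show ?thesis by (simp add: f_def)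
    next
      case False
      from norm_powr_midpoint_less[OF p False] show ?thesis by (simp add: f_def elim)
    qed
  qed
  have "(\<integral>x. f x \<partial>lborel) = (\<integral>x. norm (weak_grad v x) powr p \<partial>lborel) - (\<integral>x. norm (weak_grad u x) powr p \<partial>lborel)"
    unfolding f_def using i vw by simp
  also have "\<dots> \<le> 0" using mid unfolding u_def[abs_def] by simp
  finally have "(\<integral>x. f x \<partial>lborel) = 0" using integral_nonneg_AE[OF f0] by linarith
  then have "AE x in lborel. f x = 0"
    using integral_nonneg_eq_0_iff_AE[OF fi f0] by blast
  then show ?thesis
    using Du
  proof eventually_elim
    case (elim x)
    show ?case
    proof (rule ccontr)
      assume "weak_grad v x \<noteq> weak_grad w x"
      from norm_powr_midpoint_less[OF p this] elim show False by (simp add: f_def)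
    qed
  qed
qed

theorem proposition4p6:
  fixes p :: real and \<rho> :: "(real^'n) set \<Rightarrow> real"
    and v :: "real^'n \<Rightarrow> real" and T :: "real^'n \<Rightarrow> real^'n"
  assumes "CARD('n) \<ge> 2" and "real CARD('n) < p"
    and "admissible \<rho>"
    and "extremal p \<rho> v"
    and "morrey_seminorm p \<rho> v =
      ennreal (\<bar>signed_integral \<rho> v\<bar> /
        norm (signed_integral \<rho> (\<lambda>y. y)) powr (1 - real CARD('n) / p))"
    and "T \<in> similarities"
    and "\<forall>A \<in> sets borel. push_forward T \<rho> A = \<rho> A"
  shows "v = v \<circ> T"
proof -
  have p2: "p \<ge> 2" and p0: "p > 0" using assms(1,2) by linarith+
  note p = assms(2) and \<rho> = assms(3)
  have v: "v \<in> D1p p" and extr: "morrey_seminorm p \<rho> v = morrey_const p \<rho> * ennreal (grad_norm p v)"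
    using assms(4) by (simp_all add: extremal_def)
  have sbm: "signed_borel_measure \<rho>" using \<rho> by (simp add: admissible_def)
  obtain Q z T' where Q: "orthogonal_transformation Q" and T: "T = (\<lambda>y. Q y + z)"
    and hom: "homeomorphism UNIV UNIV T T'"
    using similarity_preserving_admissible[OF \<rho> assms(6)] assms(7) by metis
  have inv: "\<rho> (T -` A) = \<rho> A" if "A \<in> sets borel" for A
    using assms(7) that by (simp add: push_forward_def)
  define w where "w x = v (T x)" for x
  have w_eq: "w = (\<lambda>x. v (Q x + z))" by (simp add: w_def[abs_def] T)
  have w: "w \<in> D1p p" unfolding w_eq by (rule D1p_compose_isometry[OF Q v p0])
  note cv = D1p_continuous[OF v p] and cw = D1p_continuous[OF w p]
  have mv: "v \<in> borel_measurable borel" by (rule borel_measurable_continuous_onI[OF cv])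
  have gw: "(\<integral>x. norm (weak_grad w x) powr p \<partial>lborel) = (\<integral>x. norm (weak_grad v x) powr p \<partial>lborel)"
    unfolding w_eq by (rule integral_norm_weak_grad_compose_isometry[OF Q v p0])
  have quot: "morrey_seminorm p \<rho> v = ennreal (morrey_quotient p \<rho> v)"
    using assms(5) by (simp add: morrey_quotient_def)
  show ?thesis
  proof (cases "morrey_const p \<rho> = \<infinity>")
    case True
    then have "grad_norm p v = 0"
      using extr quot by (auto simp: ennreal_top_mult grad_norm_def split: if_splits)
    then have "(\<integral>x. norm (weak_grad v x) powr p \<partial>lborel) = 0" by (simp add: grad_norm_def)
    then have "AE x in lborel. norm (weak_grad v x) powr p = 0"
      using integral_nonneg_eq_0_iff_AE[OF weak_grad_integrable[OF v p0]] by simp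
    then have "AE x in lborel. weak_grad v x = 0" by eventually_elim simp
    from weak_grad_zero_imp_const[OF v p this] have "v x = v (T x)" for x by metis
    then show ?thesis by (simp add: fun_eq_iff)
  next
    case False
    define u where "u x = 1/2 * v x + 1/2 * w x" for x
    have u: "u \<in> D1p p" unfolding u_def[abs_def] by (rule D1p_lincomb[OF v w p0])
    have "signed_integral \<rho> w = signed_integral \<rho> v"
      unfolding w_def[abs_def] by (rule signed_integral_invariant[OF sbm hom inv mv])
    moreover have "signed_integral \<rho> u = 1/2 * signed_integral \<rho> v + 1/2 * signed_integral \<rho> w"
    proof -
      have "signed_integral \<rho> u = signed_integral \<rho> (\<lambda>x. 1/2 * v x) + signed_integral \<rho> (\<lambda>x. 1/2 * w x)"
        unfolding u_def[abs_def] by (intro signed_integral_add[OF \<rho>] continuous_intros cv cw)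
      then show ?thesis
        by (simp only: signed_integral_bounded_linear[OF \<rho> bounded_linear_mult_right cv]
            signed_integral_bounded_linear[OF \<rho> bounded_linear_mult_right cw])
    qed
    \<comment> \<open>The denominator depends on \<open>\<rho>\<close> alone, so equality of the
      integrals of \<open>u\<close> and \<open>v\<close> suffices.\<close>
    ultimately have "morrey_quotient p \<rho> u = morrey_quotient p \<rho> v"
      by (simp add: morrey_quotient_def)
    \<comment> \<open>By hypothesis the seminorm of \<open>v\<close> is its quotient at
      \<open>\<rho>\<close> itself. The quotient of \<open>u\<close> has the same value and, the
      identity being a similarity, bounds the seminorm of \<open>u\<close> from below.\<close>
    then have "morrey_const p \<rho> * ennreal (grad_norm p v) \<le> morrey_const p \<rho> * ennreal (grad_norm p u)"
      using morrey_quotient_le_seminorm[of p \<rho> u] morrey_inequality[OF u False] extr quot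
      by (metis order_trans)
    then have "ennreal (grad_norm p v) \<le> ennreal (grad_norm p u)"
      using morrey_const_pos[OF \<rho> p] False by (simp add: ennreal_mult_le_mult_iff)
    then have "grad_norm p v \<le> grad_norm p u"
      by (simp add: ennreal_le_iff grad_norm_def)
    then have "(\<integral>x. norm (weak_grad v x) powr p \<partial>lborel) \<le> (\<integral>x. norm (weak_grad u x) powr p \<partial>lborel)"
      using p0 powr_less_mono2[of "1 / p" "\<integral>x. norm (weak_grad u x) powr p \<partial>lborel" "\<integral>x. norm (weak_grad v x) powr p \<partial>lborel"]
      unfolding grad_norm_def by (intro leI notI) auto
    then have "AE x in lborel. weak_grad v x = weak_grad w x"
      unfolding u_def[abs_def] by (rule weak_grad_eq_of_midpoint[OF v w p2 gw])
    then have const: "v x - w x = v 0 - w 0" for x by (rule weak_grad_eq_imp_diff_const[OF v w p])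
    define c where "c = v 0 - w 0"
    interpret P: finite_measure "pos_part \<rho>" by (rule finite_measure_pos_part[OF sbm])
    have "(\<integral>x. v x \<partial>pos_part \<rho>) = (\<integral>x. w x + c \<partial>pos_part \<rho>)"
      using const by (intro Bochner_Integration.integral_cong) (auto simp: c_def algebra_simps)
    also have "\<dots> = (\<integral>x. w x \<partial>pos_part \<rho>) + measure (pos_part \<rho>) UNIV * c"
      using admissible_integrable_pos_part[OF \<rho> cw] by simp
    also have "(\<integral>x. w x \<partial>pos_part \<rho>) = (\<integral>x. v x \<partial>pos_part \<rho>)"
      unfolding w_def[abs_def] by (rule integral_pos_part_invariant[OF sbm hom inv mv])
    finally have "measure (pos_part \<rho>) UNIV * c = 0" by simp
    \<comment> \<open>Both parts have the same total mass, so if one vanishes then so does the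
      other, and with them the first moment.\<close>
    moreover have "measure (pos_part \<rho>) UNIV \<noteq> 0"
    proof
      assume 0: "measure (pos_part \<rho>) UNIV = 0"
      then have "emeasure (pos_part \<rho>) UNIV = 0" by (simp add: P.emeasure_eq_measure)
      moreover then have "emeasure (neg_part \<rho>) UNIV = 0"
        using emeasure_neg_part_UNIV[OF sbm] \<rho> by (simp add: admissible_def)
      ultimately have "UNIV \<in> null_sets (pos_part \<rho>)" "UNIV \<in> null_sets (neg_part \<rho>)"
        by (auto simp: null_sets_def)
      \<comment> \<open>When the whole space is null, every property holds almost everywhere;
        \<open>x = 0\<close> is the one that makes the integrand of the first moment vanish.\<close>
      then have "AE x in pos_part \<rho>. x = 0" "AE x in neg_part \<rho>. x = 0"
        by (auto intro: AE_I')
      then have "signed_integral \<rho> (\<lambda>y. y) = 0"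
        by (simp add: signed_integral_def integral_eq_zero_AE)
      then show False using \<rho> by (simp add: admissible_def)
    qed
    ultimately have "c = 0" by simp
    then show ?thesis using const by (auto simp: c_def w_def fun_eq_iff)
  qed
qed

end
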